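(* (1) For all $n\ge k\ge1$, $S_{\mathrm{odd}}(n,k)$ equals the number of partitions with leader of $[n]$ into $k$ blocks. (2) For all $n\ge k\ge1$, $s_{\mathrm{odd}}(n,k)$ equals the number of permutations with leader of $[n]$ with $k$ cycles. (3) For $n\ge0$ and $\mathbf{k}=(1,2,2,\ldots,2)$ (one entry $1$ followed by $n$ entries $2$, i.e. the multiset $\{0^1,1^2,\ldots,n^2\}$), for every positive integer $m$: $B_{\mathbf{k}}(m)=S_{\mathrm{odd}}(n+m,m)$ and $b_{\mathbf{k}}(m)=s_{\mathrm{odd}}(m,m-n)$. (4) For $n\ge1$ and every positive integer $m$, $$S_{\mathrm{odd}}(n+m,m)=\sum_{1\le i_1\le\cdots\le i_n\le m} i_1^2 i_2\cdots i_n,\qquad s_{\mathrm{odd}}(m,m-n)=\sum_{1\le i_1<\cdots<i_n<m} i_1^2 i_2\cdots i_n.$$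
   Context: $S_{\mathrm{odd}}(n,k)$ and $s_{\mathrm{odd}}(n,k)$ ($n,k\ge0$ integers) are defined by $S_{\mathrm{odd}}(0,0)=s_{\mathrm{odd}}(0,0)=0$, $S_{\mathrm{odd}}(n,k)=s_{\mathrm{odd}}(n,k)=0$ if $n<k$ (and all values with a negative argument are $0$), and for $n\ge1$: $S_{\mathrm{odd}}(n,k)=S_{\mathrm{odd}}(n-1,k-1)+kS_{\mathrm{odd}}(n-1,k)+\delta_{n,k}$, $s_{\mathrm{odd}}(n,k)=s_{\mathrm{odd}}(n-1,k-1)+(n-1)s_{\mathrm{odd}}(n-1,k)+\delta_{n,k}$, with $\delta$ the Kronecker delta. For a set partition $\pi=\{B_1,\ldots,B_k\}$ of $[n]$ indexed so that $\min B_1<\cdots<\min B_k$, the pair $(\ell,\pi)$ is a partition with leader if $\min B_\ell=\ell$. For a permutation $\sigma$ of $[n]$ written as a product of cycles $\sigma^{(1)}\cdots\sigma^{(k)}$ with $\min\sigma^{(1)}<\cdots<\min\sigma^{(k)}$, the pair $(\ell,\sigma)$ is a permutation with leader if $\min\sigma^{(\ell)}=\ell$. Stirling polynomials: for a tuple $\mathbf{k}=(k_1,\ldots,k_N)$ of positive integers (elements may be relabeled $0,\ldots,n$ in order), $K=\sum k_i$, a Stirling permutation of the multiset with $k_i$ copies of the $i$-th element is a word $\sigma(1)\cdots\sigma(K)$ such that $\sigma(i)=\sigma(j)$, $i<s<j$ imply $\sigma(s)\ge\sigma(i)$; index $i$ is a descent if $i<K$ and $\sigma(i)>\sigma(i+1)$,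 or $i=K$; $A_{\mathbf{k},i}$ counts those with exactly $i$ descents; $\sum_{m\ge0}B_{\mathbf{k}}(m)x^m=\frac{\sum_{i=1}^{N}A_{\mathbf{k},i}x^i}{(1-x)^{K+1}}$, $\sum_{m\ge0}b_{\mathbf{k}}(m)x^m=\frac{\sum_{i=K-N+1}^{K}A_{\mathbf{k},K+1-i}x^i}{(1-x)^{K+1}}$. *)

theory Defs
  imports
    "HOL-Library.Disjoint_Sets"
    "HOL-Combinatorics.Orbits"
    "HOL-Combinatorics.Multiset_Permutations"
    "HOL-Computational_Algebra.Formal_Power_Series"
begin

function S_odd :: "int \<Rightarrow> int \<Rightarrow> int" where
  "S_odd n k =
     (if n < 0 \<or> k < 0 \<or> n < k \<or> (n = 0 \<and> k = 0) then 0
      else S_odd (n - 1) (k - 1) + k * S_odd (n - 1) k + of_bool (n = k))"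
  by auto
termination by (relation "measure (\<lambda>(n, k). nat n)") auto

function s_odd :: "int \<Rightarrow> int \<Rightarrow> int" where
  "s_odd n k =
     (if n < 0 \<or> k < 0 \<or> n < k \<or> (n = 0 \<and> k = 0) then 0
      else s_odd (n - 1) (k - 1) + (n - 1) * s_odd (n - 1) k + of_bool (n = k))"
  by auto
termination by (relation "measure (\<lambda>(n, k). nat n)") auto

declare S_odd.simps [simp del] s_odd.simps [simp del]

text \<open>The indexing \<open>B 1, \<dots>, B (card P)\<close> of the members of a finite family of disjoint nonempty
  sets by increasing minimum is unique, so the existential quantifier only names it.\<close>

definition is_leader :: "nat \<Rightarrow> nat set set \<Rightarrow> bool" where
  "is_leader l P \<longleftrightarrow>
     (\<exists>B. bij_betw B {1..card P} P \<and>
          strict_mono_on {1..card P} (\<lambda>i. Min (B i)) \<and>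
          l \<in> {1..card P} \<and> Min (B l) = l)"

definition partitions_with_leader :: "nat \<Rightarrow> nat \<Rightarrow> (nat \<times> nat set set) set" where
  "partitions_with_leader n k =
     {(l, P). partition_on {1..n} P \<and> card P = k \<and> is_leader l P}"

text \<open>The cycles of a permutation, fixed points included, each represented by its set of elements.\<close>

definition cycles_of :: "nat \<Rightarrow> (nat \<Rightarrow> nat) \<Rightarrow> nat set set" where
  "cycles_of n \<sigma> = {C. C \<subseteq> {1..n} \<and> cyclic_on \<sigma> C}"

definition permutations_with_leader :: "nat \<Rightarrow> nat \<Rightarrow> (nat \<times> (nat \<Rightarrow> nat)) set" where
  "permutations_with_leader n k =
     {(l, \<sigma>). \<sigma> permutes {1..n} \<and> card (cycles_of n \<sigma>) = k \<and> is_leader l (cycles_of n \<sigma>)}"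

text \<open>A tuple of positive multiplicities is a list \<open>ks\<close>; the elements of the multiset are labelled
  \<open>0, \<dots>, length ks - 1\<close>. Words are lists, so the letter \<open>\<sigma>(i)\<close> is \<open>w ! (i - 1)\<close>.\<close>

definition multiset_of_tuple :: "nat list \<Rightarrow> nat multiset" where
  "multiset_of_tuple ks = (\<Sum>i<length ks. replicate_mset (ks ! i) i)"

definition stirling_permutations :: "nat list \<Rightarrow> nat list set" where
  "stirling_permutations ks =
     {w \<in> permutations_of_multiset (multiset_of_tuple ks).
        \<forall>i s j. i < s \<and> s < j \<and> j < length w \<and> w ! i = w ! j \<longrightarrow> w ! s \<ge> w ! i}"

definition descents :: "nat list \<Rightarrow> nat set" where
  "descents w =
     {i \<in> {1..length w}. (i < length w \<and> w ! (i - 1) > w ! i) \<or> i = length w}"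

definition stirling_descent_count :: "nat list \<Rightarrow> nat \<Rightarrow> nat" where
  "stirling_descent_count ks i = card {w \<in> stirling_permutations ks. card (descents w) = i}"

text \<open>The natural-number subtraction in the second generating function is exact, as
  \<open>length ks \<le> sum_list ks\<close> for positive entries.\<close>

definition stirling_B :: "nat list \<Rightarrow> nat \<Rightarrow> rat" where
  "stirling_B ks m =
     fps_nth ((\<Sum>i = 1..length ks. of_nat (stirling_descent_count ks i) * fps_X ^ i)
              / (1 - fps_X) ^ (sum_list ks + 1)) m"

definition stirling_b :: "nat list \<Rightarrow> nat \<Rightarrow> rat" where
  "stirling_b ks m =
     fps_nth ((\<Sum>i = sum_list ks - length ks + 1..sum_list ks.
                 of_nat (stirling_descent_count ks (sum_list ks + 1 - i)) * fps_X ^ i)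
              / (1 - fps_X) ^ (sum_list ks + 1)) m"

end

theory Submission
  imports Defs "HOL-Library.Sublist"
begin

text \<open>
  All four descriptions satisfy the recurrences of \<open>S_odd\<close> and \<open>s_odd\<close>. Deleting the largest element
  of a partition or permutation keeps the set of block minima, apart from that element itself, and the
  number of leaders is the length of the longest initial segment \<open>1, \<dots>, l\<close> of the set of minima; the
  Kronecker delta accounts for the unique structure all of whose blocks are singletons.
  For Stirling permutations, the two copies of the largest letter \<open>n\<close> are adjacent, and inserting them
  into one of the \<open>2 n\<close> gaps of a smaller word adds a descent unless the gap already is one. So
  \<open>A (n, i) = i A (n - 1, i) + (2 n + 1 - i) A (n - 1, i - 1)\<close>, which says that the generating
  functions \<open>F\<^sub>n\<close> of \<open>B\<close> and \<open>G\<^sub>n\<close> of \<open>b\<close> satisfy \<open>(1 - x) F\<^sub>n = x F\<^sub>n\<^sub>-\<^sub>1'\<close> and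
  \<open>(1 - x) G\<^sub>n = x\<^sup>2 G\<^sub>n\<^sub>-\<^sub>1'\<close>. In the sums one splits off the last index.
\<close>

section \<open>The recurrences over the natural numbers\<close>

lemma S_odd_eq_0: "n < k \<Longrightarrow> S_odd n k = 0"
  by (subst S_odd.simps) auto

lemma s_odd_eq_0: "n < k \<Longrightarrow> s_odd n k = 0"
  by (subst s_odd.simps) auto

text \<open>For \<open>k \<le> n\<close> the guard in the definition does not fire; for
  \<open>n < k\<close> every term on both sides is zero. So the recurrence holds over all natural
  numbers.\<close>

lemma S_odd_nat_rec:
  "S_odd (int (Suc n)) (int (Suc k)) =
     S_odd (int n) (int k) + int (Suc k) * S_odd (int n) (int (Suc k)) + of_bool (n = k)"
proof (cases "k \<le> n")
  case True
  then show ?thesis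
    by (subst S_odd.simps) simp
qed (simp add: S_odd_eq_0)

lemma s_odd_nat_rec:
  "s_odd (int (Suc n)) (int (Suc k)) =
     s_odd (int n) (int k) + int n * s_odd (int n) (int (Suc k)) + of_bool (n = k)"
proof (cases "k \<le> n")
  case True
  then show ?thesis
    by (subst s_odd.simps) simp
qed (simp add: s_odd_eq_0)

lemma S_odd_0_left: "S_odd 0 k = 0"
  by (subst S_odd.simps) auto

lemma s_odd_0_left: "s_odd 0 k = 0"
  by (subst s_odd.simps) auto

lemma S_odd_neg: "k < 0 \<Longrightarrow> S_odd n k = 0"
  by (subst S_odd.simps) auto

lemma s_odd_neg: "k < 0 \<Longrightarrow> s_odd n k = 0"
  by (subst s_odd.simps) auto

lemma S_odd_0_right: "S_odd (int n) 0 = 0"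
  by (induction n) (simp_all add: S_odd_0_left S_odd_neg S_odd.simps[of "1 + _"])

lemma s_odd_0_right: "s_odd (int n) 0 = 0"
  by (induction n) (simp_all add: s_odd_0_left s_odd_neg s_odd.simps[of "1 + _"])

text \<open>Values with \<open>n < k\<close> vanish, so each step along the diagonal adds only the
  delta.\<close>

lemma S_odd_diag: "S_odd (int n) (int n) = int n"
  by (induction n) (simp_all add: S_odd_0_left S_odd_nat_rec S_odd_eq_0 del: of_nat_Suc)

lemma s_odd_diag: "s_odd (int n) (int n) = int n"
  by (induction n) (simp_all add: s_odd_0_left s_odd_nat_rec s_odd_eq_0 del: of_nat_Suc)

text \<open>In coordinates along the diagonals the delta disappears, because \<open>Suc n\<close> is
  positive. The sums and the generating functions use this form.\<close>

lemma S_odd_shift_rec: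
  "S_odd (int (Suc n) + int (Suc m)) (int (Suc m)) =
     S_odd (int (Suc n) + int m) (int m) + int (Suc m) * S_odd (int n + int (Suc m)) (int (Suc m))"
  using S_odd_nat_rec[of "Suc (n + m)" m] by (simp add: algebra_simps)

lemma s_odd_shift_rec:
  "s_odd (int (Suc m)) (int (Suc m) - int (Suc n)) =
     s_odd (int m) (int m - int (Suc n)) + int m * s_odd (int m) (int m - int n)"
proof (cases "m \<le> n")
  \<comment> \<open>All second arguments are zero or negative here, so the three values
    vanish.\<close>
  case True
  then show ?thesis
    using s_odd_0_right[of "Suc m"] s_odd_0_right[of m]
    by (cases "m = n") (auto simp: s_odd_neg)
next
  case False
  then have "int (m - Suc n) = int m - int (Suc n)" "int (Suc (m - Suc n)) = int m - int n"
    by auto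
  with s_odd_nat_rec[of m "m - Suc n"] False show ?thesis
    by simp
qed

section \<open>Leaders\<close>

text \<open>The \<open>l\<close>-th smallest minimum equals \<open>l\<close> exactly if \<open>1, \<dots>, l\<close> all are minima; the leaders thus
  depend only on the set of minima.\<close>

definition leaders :: "nat set \<Rightarrow> nat set" where
  "leaders M = {l. 1 \<le> l \<and> {1..l} \<subseteq> M}"

lemma leaders_empty [simp]: "leaders {} = {}"
  by (auto simp: leaders_def)

lemma leaders_subset: "leaders M \<subseteq> M"
  by (auto simp: leaders_def)

text \<open>Whether some \<open>l \<le> n\<close> is a leader depends on \<open>M\<close> alone, so
  only \<open>Suc n\<close> can be a new leader, and it is one exactly if \<open>M\<close> is
  already full. This is the source of the Kronecker delta.\<close>

lemma card_leaders_insert: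
  assumes "M \<subseteq> {1..n}"
  shows "card (leaders (insert (Suc n) M)) = card (leaders M) + of_bool (M = {1..n})"
proof -
  have fin: "finite (leaders M)"
    using assms leaders_subset[of M] by (meson finite_atLeastAtMost finite_subset)
  have new: "l \<in> leaders (insert (Suc n) M) \<longleftrightarrow> l \<in> leaders M \<or> (M = {1..n} \<and> l = Suc n)" for l
  proof (cases "l \<le> n")
    case True
    then show ?thesis
      by (auto simp: leaders_def subset_iff)
  next
    case False
    then have "{1..l} \<subseteq> insert (Suc n) M \<longleftrightarrow> M = {1..n} \<and> l = Suc n"
    proof (intro iffI)
      assume *: "{1..l} \<subseteq> insert (Suc n) M"
      with assms False have "l = Suc n"
        using subsetD[OF *, of l] subsetD[OF assms, of l] by auto
      moreover have "{1..n} \<subseteq> M"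
        using * \<open>l = Suc n\<close> by force
      ultimately show "M = {1..n} \<and> l = Suc n"
        using assms by auto
    qed auto
    moreover have "l \<notin> leaders M"
      using False assms leaders_subset by fastforce
    ultimately show ?thesis
      using False by (auto simp: leaders_def)
  qed
  show ?thesis
  proof (cases "M = {1..n}")
    case True
    then have "leaders (insert (Suc n) M) = insert (Suc n) (leaders M)"
      using new by auto
    moreover have "Suc n \<notin> leaders M"
      using assms leaders_subset by fastforce
    ultimately show ?thesis
      using fin True by simp
  next
    case False
    then have "leaders (insert (Suc n) M) = leaders M"
      using new by auto
    then show ?thesis
      using False by simp
  qed
qed

section \<open>Increasing enumeration of the block minima\<close>

lemma strict_mono_on_ge_index:
  fixes f :: "nat \<Rightarrow> nat"
  assumes "strict_mono_on {1..k} f" "\<And>i. i \<in> {1..k} \<Longrightarrow> 1 \<le> f i" "i \<in> {1..k}"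
  shows "i \<le> f i"
  using assms(3)
proof (induction i)
  case (Suc i)
  show ?case
  proof (cases "i = 0")
    case False
    then have "i \<le> f i" using Suc by auto
    also have "f i < f (Suc i)"
      using False Suc.prems by (intro strict_mono_onD[OF assms(1)]) auto
    finally show ?thesis by simp
  qed (use assms(2) Suc in auto)
qed simp

text \<open>From \<open>f l = l\<close>, going down from \<open>l\<close> gives
  \<open>f i \<le> i\<close>, and \<open>i \<le> f i\<close> always holds, so \<open>f\<close> fixes
  \<open>1, ..., l\<close>. Conversely, if \<open>l < f l\<close>, the \<open>l\<close> values
  \<open>1, ..., l\<close> would have to be taken at the \<open>l - 1\<close> indices below
  \<open>l\<close>.\<close>

lemma strict_mono_on_eq_index_iff:
  fixes f :: "nat \<Rightarrow> nat"
  assumes mono: "strict_mono_on {1..k} f" and pos: "\<And>i. i \<in> {1..k} \<Longrightarrow> 1 \<le> f i"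
    and l: "l \<in> {1..k}"
  shows "f l = l \<longleftrightarrow> {1..l} \<subseteq> f ` {1..k}"
proof
  assume fl: "f l = l"
  have le: "f (l - j) \<le> l - j" if "j < l" for j
    using that
  proof (induction j)
    case (Suc j)
    then have "f (l - Suc j) < f (l - j)"
      using l by (intro strict_mono_onD[OF mono]) auto
    with Suc show ?case by simp
  qed (simp add: fl)
  show "{1..l} \<subseteq> f ` {1..k}"
  proof
    fix i assume i: "i \<in> {1..l}"
    then have "f i \<le> i"
      using le[of "l - i"] by simp
    moreover have "i \<le> f i"
      using i l by (intro strict_mono_on_ge_index[OF mono pos]) auto
    ultimately show "i \<in> f ` {1..k}"
      using i l by (intro image_eqI[of _ _ i]) auto
  qed
next
  assume sub: "{1..l} \<subseteq> f ` {1..k}"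
  have "l \<le> f l"
    by (rule strict_mono_on_ge_index[OF mono pos l])
  moreover have "\<not> l < f l"
  proof
    assume less: "l < f l"
    have "{1..l} \<subseteq> f ` {1..<l}"
    proof
      fix x assume x: "x \<in> {1..l}"
      then obtain i where i: "i \<in> {1..k}" "x = f i"
        using sub by auto
      have "i < l"
      proof (rule ccontr)
        assume "\<not> i < l"
        then have "f l \<le> f i"
          using i l strict_mono_onD[OF mono, of l i] by (cases "i = l") auto
        then show False using less i x by auto
      qed
      then show "x \<in> f ` {1..<l}" using i by auto
    qed
    then have "card {1..l} \<le> card (f ` {1..<l})"
      by (intro card_mono) auto
    also have "\<dots> \<le> card {1..<l}"
      by (rule card_image_le) simp
    finally have "l \<le> l - 1" by simp
    then show False using l by auto
  qed
  ultimately show "f l = l" by simp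
qed

lemma finite_Min_inj_on_partition:
  fixes P :: "nat set set"
  assumes "partition_on {1..n} P"
  shows "finite P" "inj_on Min P" "Min ` P \<subseteq> {1..n}"
proof -
  have Min: "B \<subseteq> {1..n}" "finite B" "Min B \<in> B" if "B \<in> P" for B
  proof -
    show *: "B \<subseteq> {1..n}"
      using that assms by (auto simp: partition_on_def)
    then show "finite B"
      using finite_subset by blast
    then show "Min B \<in> B"
      using that assms by (auto simp: partition_on_def intro!: Min_in)
  qed
  show "finite P"
    using assms finite_elements by blast
  show "inj_on Min P"
  proof (rule inj_onI)
    fix B C assume "B \<in> P" "C \<in> P" "Min B = Min C"
    with Min(3)[of B] Min(3)[of C] partition_onD2[OF assms] show "B = C"
      by (auto simp: disjoint_def)
  qed
  show "Min ` P \<subseteq> {1..n}"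
    using Min by blast
qed

text \<open>The condition on \<open>l\<close> is the same for every admissible indexing
  \<open>B\<close>, so it remains to exhibit one: sort the minima and pull them back along
  \<open>Min\<close>, which is injective on the blocks.\<close>

lemma is_leader_iff:
  assumes "partition_on {1..n} P"
  shows "is_leader l P \<longleftrightarrow> l \<in> leaders (Min ` P)"
proof -
  define k where "k = card P"
  note P = finite_Min_inj_on_partition[OF assms]
  have iff: "(l \<in> {1..k} \<and> Min (B l) = l) \<longleftrightarrow> l \<in> leaders (Min ` P)"
    if B: "bij_betw B {1..k} P" "strict_mono_on {1..k} (\<lambda>i. Min (B i))" for B
  proof -
    have img: "(\<lambda>i. Min (B i)) ` {1..k} = Min ` P"
      using bij_betw_imp_surj_on[OF B(1)] by auto
    have pos: "1 \<le> Min (B i)" if "i \<in> {1..k}" for i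
      using that img P(3) by (metis atLeastAtMost_iff image_eqI subsetD)
    have "Min (B l) = l \<longleftrightarrow> {1..l} \<subseteq> Min ` P" if "l \<in> {1..k}"
      using strict_mono_on_eq_index_iff[OF B(2) pos that] unfolding img .
    \<comment> \<open>The bound on \<open>l\<close>, absent from \<open>leaders\<close>, follows by
      counting minima.\<close>
    moreover have "l \<le> k" if "{1..l} \<subseteq> Min ` P"
      using card_mono[OF _ that] P by (simp add: card_image k_def)
    ultimately show ?thesis
      by (auto simp: leaders_def)
  qed
  obtain B where "bij_betw B {1..k} P" "strict_mono_on {1..k} (\<lambda>i. Min (B i))"
  proof
    define xs where "xs = sorted_list_of_set (Min ` P)"
    have xs: "set xs = Min ` P" "sorted_wrt (<) xs" "length xs = k"
      using P by (auto simp: xs_def k_def card_image)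
    define B where "B i = inv_into P Min (xs ! (i - 1))" for i
    have MinB: "Min (B i) = xs ! (i - 1)" if "i \<in> {1..k}" for i
      unfolding B_def using that xs by (intro f_inv_into_f) (auto simp flip: xs(1))
    show mono: "strict_mono_on {1..k} (\<lambda>i. Min (B i))"
    proof (rule strict_mono_onI)
      fix i j assume "i \<in> {1..k}" "j \<in> {1..k}" "i < j"
      then show "Min (B i) < Min (B j)"
        using sorted_wrt_nth_less[OF xs(2), of "i - 1" "j - 1"] xs(3) by (simp add: MinB)
    qed
    have "inj_on B {1..k}"
      using strict_mono_on_imp_inj_on[OF mono] unfolding inj_on_def by metis
    moreover have "B i \<in> P" if "i \<in> {1..k}" for i
      unfolding B_def using that xs by (intro inv_into_into) (auto simp flip: xs(1))
    then have "B ` {1..k} \<subseteq> P"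
      by blast
    ultimately show "bij_betw B {1..k} P"
      using P(1) by (simp add: bij_betw_def card_subset_eq card_image k_def)
  qed
  then show ?thesis
    unfolding is_leader_def k_def[symmetric] using iff by blast
qed

section \<open>Insertion of the largest element\<close>

text \<open>What partitions and permutations have in common: each structure on \<open>n + 1\<close>
  elements arises uniquely from one on \<open>n\<close> elements by inserting \<open>Suc n\<close>,
  either at the place \<open>new\<close>, as a block of its own, or at a place in
  \<open>old\<close>, which keeps the minima. \<open>c n k\<close> is the number of old places when
  there are \<open>k\<close> minima; it becomes the coefficient in the recurrence.\<close>

locale block_insertion =
  fixes X :: "nat \<Rightarrow> 'a set" and mins :: "nat \<Rightarrow> 'a \<Rightarrow> nat set"
    and new :: "nat \<Rightarrow> 'b" and old :: "nat \<Rightarrow> 'a \<Rightarrow> 'b set"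
    and ins :: "nat \<Rightarrow> 'a \<times> 'b \<Rightarrow> 'a" and c :: "nat \<Rightarrow> nat \<Rightarrow> nat"
  assumes card_X_0: "card (X 0) = 1"
    and mins_subset: "x \<in> X n \<Longrightarrow> mins n x \<subseteq> {1..n}"
    and bij_ins: "bij_betw (ins n) (SIGMA x:X n. insert (new n) (old n x)) (X (Suc n))"
    and new_notin: "x \<in> X n \<Longrightarrow> new n \<notin> old n x"
    and finite_old: "x \<in> X n \<Longrightarrow> finite (old n x)"
    and card_old: "x \<in> X n \<Longrightarrow> card (old n x) = c n (card (mins n x))"
    and mins_new: "x \<in> X n \<Longrightarrow> mins (Suc n) (ins n (x, new n)) = insert (Suc n) (mins n x)"
    and mins_old: "x \<in> X n \<Longrightarrow> b \<in> old n x \<Longrightarrow> mins (Suc n) (ins n (x, b)) = mins n x"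
begin

lemma finite_X: "finite (X n)"
proof (induction n)
  case 0
  then show ?case using card_X_0 card.infinite by fastforce
next
  case (Suc n)
  then have "finite (SIGMA x:X n. insert (new n) (old n x))"
    using finite_old by auto
  then show ?case using bij_betw_finite[OF bij_ins] by blast
qed

lemma sum_X_Suc:
  fixes f :: "'a \<Rightarrow> nat"
  shows "(\<Sum>y\<in>X (Suc n). f y) = (\<Sum>x\<in>X n. f (ins n (x, new n)) + (\<Sum>b\<in>old n x. f (ins n (x, b))))"
proof -
  have "(\<Sum>y\<in>X (Suc n). f y) = (\<Sum>p\<in>(SIGMA x:X n. insert (new n) (old n x)). f (ins n p))"
    by (rule sum.reindex_bij_betw[OF bij_ins, symmetric])
  also have "\<dots> = (\<Sum>x\<in>X n. \<Sum>b\<in>insert (new n) (old n x). f (ins n (x, b)))"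
    using finite_X finite_old by (subst sum.Sigma) (auto simp: split_def)
  also have "\<dots> = (\<Sum>x\<in>X n. f (ins n (x, new n)) + (\<Sum>b\<in>old n x. f (ins n (x, b))))"
    using finite_old new_notin by (intro sum.cong) auto
  finally show ?thesis .
qed

lemma Suc_notin_mins: "x \<in> X n \<Longrightarrow> Suc n \<notin> mins n x"
  using mins_subset by fastforce

text \<open>Insertion at an old place leaves \<open>Suc n\<close> out of the minima. So a structure
  with a full set of minima arises only at \<open>new\<close>, from the one such structure of the
  previous size.\<close>

lemma count_all_mins: "(\<Sum>x\<in>X n. of_bool (mins n x = {1..n})) = (1 :: nat)"
proof (induction n)
  case 0
  have "mins 0 x = {}" if "x \<in> X 0" for x
    using mins_subset[OF that] by simp
  then show ?case using card_X_0 by simp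
next
  case (Suc n)
  have new: "insert (Suc n) (mins n x) = {1..Suc n} \<longleftrightarrow> mins n x = {1..n}"
    and old: "mins n x \<noteq> {1..Suc n}" if "x \<in> X n" for x
  proof -
    have "{1..Suc n} = insert (Suc n) {1..n}" by auto
    then show "insert (Suc n) (mins n x) = {1..Suc n} \<longleftrightarrow> mins n x = {1..n}"
      using Suc_notin_mins[OF that] by (simp add: insert_ident)
    show "mins n x \<noteq> {1..Suc n}"
      using Suc_notin_mins[OF that] by auto
  qed
  have "(\<Sum>x\<in>X (Suc n). of_bool (mins (Suc n) x = {1..Suc n})) =
          (\<Sum>x\<in>X n. of_bool (mins n x = {1..n}) :: nat)"
    unfolding sum_X_Suc by (intro sum.cong) (simp_all add: mins_new mins_old new old del: One_nat_def)
  with Suc show ?case by simp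
qed

text \<open>The condition on the number of blocks stands inside the sum, so that
  \<open>sum_X_Suc\<close> applies to the sum over all of \<open>X n\<close>.\<close>

definition leader_count :: "nat \<Rightarrow> nat \<Rightarrow> nat" where
  "leader_count n k = (\<Sum>x\<in>X n. if card (mins n x) = k then card (leaders (mins n x)) else 0)"

lemma leader_count_0_left: "leader_count 0 k = 0"
proof -
  have "mins 0 x = {}" if "x \<in> X 0" for x
    using mins_subset[OF that] by simp
  then show ?thesis by (auto simp: leader_count_def intro!: sum.neutral)
qed

lemma leader_count_0_right: "leader_count n 0 = 0"
proof -
  have "mins n x = {}" if "x \<in> X n" "card (mins n x) = 0" for x
    using mins_subset[OF that(1)] that(2) finite_subset[of "mins n x" "{1..n}"] by auto
  have "card (leaders (mins n x)) = 0" if "x \<in> X n" "card (mins n x) = 0" for x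
    unfolding \<open>\<And>x. x \<in> X n \<Longrightarrow> card (mins n x) = 0 \<Longrightarrow> mins n x = {}\<close>[OF that] by simp
  then show ?thesis unfolding leader_count_def by (intro sum.neutral) simp
qed

text \<open>Insertion at \<open>new\<close> adds a block and keeps the leaders, except for one
  further leader if the minima are full, which forces \<open>n = k\<close>. Insertion at an old
  place changes neither number, and there are \<open>c n (Suc k)\<close> such places.\<close>

lemma leader_count_Suc:
  "leader_count (Suc n) (Suc k) =
     leader_count n k + c n (Suc k) * leader_count n (Suc k) + of_bool (n = k)"
proof -
  let ?M = "mins n"
  let ?w = "\<lambda>k x. if card (?M x) = k then card (leaders (?M x)) else 0"
  have "leader_count (Suc n) (Suc k) =
      (\<Sum>x\<in>X n. ?w k x + of_bool (n = k) * of_bool (?M x = {1..n}) + c n (Suc k) * ?w (Suc k) x)"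
    unfolding leader_count_def sum_X_Suc
  proof (intro sum.cong refl)
    fix x assume x: "x \<in> X n"
    have "finite (?M x)"
      using mins_subset[OF x] finite_subset by blast
    then have card_insert: "card (insert (Suc n) (?M x)) = Suc (card (?M x))"
      using Suc_notin_mins[OF x] by simp
    have full: "card (?M x) = n" if "?M x = {1..n}"
      using that by simp
    have "(if card (mins (Suc n) (ins n (x, new n))) = Suc k
            then card (leaders (mins (Suc n) (ins n (x, new n)))) else 0) =
          ?w k x + of_bool (n = k) * of_bool (?M x = {1..n})"
      using full by (auto simp: mins_new[OF x] card_insert card_leaders_insert[OF mins_subset[OF x]])
    moreover have "(\<Sum>b\<in>old n x. if card (mins (Suc n) (ins n (x, b))) = Suc k
            then card (leaders (mins (Suc n) (ins n (x, b)))) else 0) = c n (Suc k) * ?w (Suc k) x"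
      using card_old[OF x] by (simp add: mins_old[OF x])
    ultimately show "(if card (mins (Suc n) (ins n (x, new n))) = Suc k
            then card (leaders (mins (Suc n) (ins n (x, new n)))) else 0) +
          (\<Sum>b\<in>old n x. if card (mins (Suc n) (ins n (x, b))) = Suc k
            then card (leaders (mins (Suc n) (ins n (x, b)))) else 0) =
          ?w k x + of_bool (n = k) * of_bool (?M x = {1..n}) + c n (Suc k) * ?w (Suc k) x"
      by linarith
  qed
  also have "\<dots> = leader_count n k + of_bool (n = k) * (\<Sum>x\<in>X n. of_bool (?M x = {1..n})) +
      c n (Suc k) * leader_count n (Suc k)"
    unfolding sum.distrib sum_distrib_left leader_count_def ..
  finally show ?thesis
    unfolding count_all_mins by simp
qed

lemma card_with_leader:
  "card {(l, x). x \<in> X n \<and> card (mins n x) = k \<and> l \<in> leaders (mins n x)} = leader_count n k"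
proof -
  let ?Y = "{x \<in> X n. card (mins n x) = k}"
  have fin: "finite (leaders (mins n x))" if "x \<in> X n" for x
    using leaders_subset mins_subset[OF that] by (meson finite_atLeastAtMost finite_subset)
  have "{(l, x). x \<in> X n \<and> card (mins n x) = k \<and> l \<in> leaders (mins n x)} =
      prod.swap ` (SIGMA x:?Y. leaders (mins n x))"
    by (auto simp: image_iff)
  then have "card {(l, x). x \<in> X n \<and> card (mins n x) = k \<and> l \<in> leaders (mins n x)} =
      card (SIGMA x:?Y. leaders (mins n x))"
    by (simp add: card_image)
  also have "\<dots> = (\<Sum>x\<in>?Y. card (leaders (mins n x)))"
    using finite_X fin by (intro card_SigmaI) auto
  also have "\<dots> = leader_count n k"
    unfolding leader_count_def by (rule sum.inter_filter[OF finite_X])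
  finally show ?thesis .
qed

end

section \<open>Set partitions\<close>

text \<open>Taking \<open>B = {}\<close> adds the singleton block \<open>{N}\<close>.\<close>

definition insert_in_block :: "nat \<Rightarrow> nat set set \<Rightarrow> nat set \<Rightarrow> nat set set" where
  "insert_in_block N P B = insert (insert N B) (P - {B})"

lemma partition_insert_in_block:
  assumes "partition_on A P" "N \<notin> A" "B \<in> insert {} P"
  shows "partition_on (insert N A) (insert_in_block N P B)"
proof -
  have B: "B \<subseteq> A" "B \<inter> \<Union>(P - {B}) = {}" "A = \<Union>P"
    using assms by (auto simp: partition_on_def disjoint_def)
  show ?thesis
    unfolding insert_in_block_def
  proof (rule partition_onI)
    show "\<Union>(insert (insert N B) (P - {B})) = insert N A"
      using B assms(3) by auto
    show "{} \<notin> insert (insert N B) (P - {B})"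
      using assms by (auto simp: partition_on_def)
    have new: "disjnt (insert N B) q" if "q \<in> P - {B}" for q
      using that B assms(2) by (auto simp: disjnt_def)
    show "disjnt p q" if "p \<in> insert (insert N B) (P - {B})" "q \<in> insert (insert N B) (P - {B})"
      "p \<noteq> q" for p q
      using that new[of p] new[of q] partition_onD2[OF assms(1)]
      unfolding pairwise_def by (metis DiffD1 disjnt_sym insert_iff)
  qed
qed

text \<open>Delete \<open>N\<close> from its block \<open>D\<close>. If \<open>D\<close> was the
  singleton, nothing is left and the block is dropped, which corresponds to
  \<open>B = {}\<close>.\<close>

lemma partition_insert_in_blockE:
  assumes "partition_on (insert N A) Q" "N \<notin> A"
  obtains P B where "partition_on A P" "B \<in> insert {} P" "Q = insert_in_block N P B"
proof -
  obtain D where D: "D \<in> Q" "N \<in> D"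
    using assms(1) by (auto simp: partition_on_def)
  define B where "B = D - {N}"
  define P where "P = (if B = {} then Q - {D} else insert B (Q - {D}))"
  have rest: "N \<notin> E" "E \<inter> B = {}" "E \<noteq> {}" "E \<subseteq> A" if "E \<in> Q - {D}" for E
  proof -
    have "E \<inter> D = {}"
      using that D partition_onD2[OF assms(1)] by (auto simp: disjoint_def)
    then show "N \<notin> E" "E \<inter> B = {}"
      using D(2) by (auto simp: B_def)
    then show "E \<noteq> {}" "E \<subseteq> A"
      using that partition_onD1[OF assms(1)] partition_onD3[OF assms(1)] by auto
  qed
  have un: "\<Union>Q = insert N A"
    using assms(1) by (auto simp: partition_on_def)
  have "partition_on A P"
  proof (rule partition_onI)
    have "\<Union>P = B \<union> \<Union>(Q - {D})"
      by (auto simp: P_def)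
    also have "\<dots> = A"
      using un D rest(4) assms(2) by (auto simp: B_def)
    finally show "\<Union>P = A" .
    show "{} \<notin> P"
      using rest(3) by (auto simp: P_def split: if_splits)
    show "disjnt p q" if "p \<in> P" "q \<in> P" "p \<noteq> q" for p q
    proof -
      have "disjnt E B" "disjnt B E" if "E \<in> Q - {D}" for E
        using rest(2)[OF that] by (auto simp: disjnt_def)
      then show ?thesis
        using that partition_onD2[OF assms(1)]
        by (auto simp: P_def pairwise_def split: if_splits)
    qed
  qed
  moreover have "B \<in> insert {} P"
    by (auto simp: P_def)
  moreover have "P - {B} = Q - {D}"
    using rest by (auto simp: P_def)
  then have "Q = insert_in_block N P B"
    using D by (auto simp: insert_in_block_def B_def insert_absorb)
  ultimately show ?thesis using that by blast
qed

text \<open>The only member containing \<open>N\<close> determines \<open>B\<close>, and the members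
  without \<open>N\<close> are those of \<open>P - {B}\<close>. As \<open>{}\<close> is no block,
  \<open>B\<close> then tells whether it has to be put back.\<close>

lemma insert_in_block_inject:
  assumes "partition_on A P" "partition_on A P'" "N \<notin> A"
    and "B \<in> insert {} P" "B' \<in> insert {} P'"
    and eq: "insert_in_block N P B = insert_in_block N P' B'"
  shows "P = P'" "B = B'"
proof -
  have N: "N \<notin> E" if "E \<in> insert {} P \<union> insert {} P'" for E
    using that assms(1-3) by (auto simp: partition_on_def)
  have "insert N B \<in> insert_in_block N P' B'"
    using eq by (auto simp: insert_in_block_def)
  then have "insert N B = insert N B'"
    using N by (auto simp: insert_in_block_def)
  then show "B = B'"
    using N[of B] N[of B'] assms(4,5) by (metis UnI1 UnI2 insert_ident)
  have "P - {B} = {E \<in> insert_in_block N P B. N \<notin> E}" "P' - {B'} = {E \<in> insert_in_block N P' B'. N \<notin> E}"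
    using N by (auto simp: insert_in_block_def)
  then have "P - {B} = P' - {B}"
    using eq \<open>B = B'\<close> by simp
  moreover have "{} \<notin> P" "{} \<notin> P'"
    using assms(1,2) by (auto simp: partition_on_def)
  ultimately show "P = P'"
    using assms(4,5) \<open>B = B'\<close> by (cases "B = {}") auto
qed

text \<open>The inserted element exceeds all others, so it is a minimum only in a block of its
  own.\<close>

lemma Min_image_insert_in_block:
  assumes P: "partition_on {1..n} P" and "B \<in> insert {} P"
  shows "Min ` insert_in_block (Suc n) P B = (if B = {} then insert (Suc n) (Min ` P) else Min ` P)"
proof (cases "B = {}")
  case True
  then show ?thesis
    using partition_onD3[OF P] by (simp add: insert_in_block_def)
next
  case False
  with assms have B: "B \<in> P" "B \<subseteq> {1..n}" "finite B"
    by (auto simp: partition_on_def intro: finite_subset)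
  then have "Min B \<le> Suc n"
    using False by (meson Min_in atLeastAtMost_iff le_SucI subsetD)
  then have "Min (insert (Suc n) B) = Min B"
    using B False by simp
  then have "Min ` insert_in_block (Suc n) P B = Min ` insert B (P - {B})"
    unfolding insert_in_block_def by (metis image_insert)
  also have "insert B (P - {B}) = P"
    using B by auto
  finally show ?thesis using False by simp
qed

text \<open>The places are the blocks themselves, with \<open>{}\<close> as the new one. Hence
  \<open>c n k = k\<close>, the coefficient for \<open>S_odd\<close>.\<close>

global_interpretation partitions: block_insertion
  "\<lambda>n. {P. partition_on {1..n} P}" "\<lambda>n P. Min ` P" "\<lambda>n. {}" "\<lambda>n P. P"
  "\<lambda>n (P, B). insert_in_block (Suc n) P B" "\<lambda>n k. k"
  defines partition_leader_count = partitions.leader_count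
proof
  show "card {P :: nat set set. partition_on {1..0} P} = 1"
    by (simp add: partition_on_empty)
  fix n
  have Suc: "{1..Suc n} = insert (Suc n) {1..n}"
    by auto
  show "bij_betw (\<lambda>(P, B). insert_in_block (Suc n) P B)
      (SIGMA P:{P. partition_on {1..n} P}. insert {} P) {P. partition_on {1..Suc n} P}"
    unfolding Suc bij_betw_def
  proof
    show "inj_on (\<lambda>(P, B). insert_in_block (Suc n) P B)
        (SIGMA P:{P. partition_on {1..n} P}. insert {} P)"
    proof (rule inj_onI, clarify)
      fix P B P' B'
      assume "partition_on {1..n} P" "B \<in> insert {} P" "partition_on {1..n} P'" "B' \<in> insert {} P'"
        "insert_in_block (Suc n) P B = insert_in_block (Suc n) P' B'"
      then show "P = P' \<and> B = B'"
        using insert_in_block_inject[of "{1..n}" P P' "Suc n" B B'] by simp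
    qed
    show "(\<lambda>(P, B). insert_in_block (Suc n) P B) ` (SIGMA P:{P. partition_on {1..n} P}. insert {} P) =
        {P. partition_on (insert (Suc n) {1..n}) P}"
    proof (intro set_eqI iffI)
      fix Q assume "Q \<in> {P. partition_on (insert (Suc n) {1..n}) P}"
      then obtain P B where "partition_on {1..n} P" "B \<in> insert {} P" "Q = insert_in_block (Suc n) P B"
        using partition_insert_in_blockE[of "Suc n" "{1..n}" Q] by auto
      then show "Q \<in> (\<lambda>(P, B). insert_in_block (Suc n) P B) `
          (SIGMA P:{P. partition_on {1..n} P}. insert {} P)"
        by force
    qed (use partition_insert_in_block[of "{1..n}" _ "Suc n"] in auto)
  qed
next
  fix P :: "nat set set" and n :: nat
  assume "P \<in> {P. partition_on {1..n} P}"
  then have P: "partition_on {1..n} P" by simp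
  note fin = finite_Min_inj_on_partition[OF P]
  show "Min ` P \<subseteq> {1..n}" "finite P" "card P = card (Min ` P)" "{} \<notin> P"
    using fin partition_onD3[OF P] by (auto simp: card_image)
  show "Min ` (case (P, {}) of (P, B) \<Rightarrow> insert_in_block (Suc n) P B) = insert (Suc n) (Min ` P)"
    using Min_image_insert_in_block[OF P, of "{}"] by simp
  show "Min ` (case (P, B) of (P, B) \<Rightarrow> insert_in_block (Suc n) P B) = Min ` P" if "B \<in> P" for B
    using Min_image_insert_in_block[OF P, of B] that partition_onD3[OF P] by auto
qed

lemma S_odd_eq_leader_count: "S_odd (int n) (int k) = int (partition_leader_count n k)"
proof (induction n arbitrary: k)
  case 0
  then show ?case by (simp add: S_odd_0_left partitions.leader_count_0_left)
next
  case (Suc n)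
  show ?case
  proof (cases k)
    case 0
    then show ?thesis
      using S_odd_0_right[of "Suc n"] by (simp add: partitions.leader_count_0_right)
  next
    case (Suc k')
    then show ?thesis
      by (simp only: S_odd_nat_rec Suc.IH partitions.leader_count_Suc of_nat_add of_nat_mult of_nat_of_bool)
  qed
qed

lemma S_odd_eq_card_partitions_with_leader:
  "S_odd (int n) (int k) = int (card (partitions_with_leader n k))"
proof -
  have "partitions_with_leader n k =
      {(l, P). P \<in> {P. partition_on {1..n} P} \<and> card (Min ` P) = k \<and> l \<in> leaders (Min ` P)}"
    unfolding partitions_with_leader_def
    using finite_Min_inj_on_partition by (auto simp: card_image is_leader_iff)
  then show ?thesis
    using partitions.card_with_leader[of n k] by (simp add: S_odd_eq_leader_count)
qed

section \<open>Permutations\<close>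

text \<open>A cyclic set is the orbit of each of its points, so a cycle that shares a point with a
  member of \<open>P\<close> equals that member.\<close>

lemma cycles_of_eqI:
  assumes P: "partition_on {1..n} P" and cyc: "\<And>C. C \<in> P \<Longrightarrow> cyclic_on \<sigma> C"
  shows "cycles_of n \<sigma> = P"
proof (intro set_eqI iffI)
  fix C assume "C \<in> cycles_of n \<sigma>"
  then have C: "C \<subseteq> {1..n}" "cyclic_on \<sigma> C" by (auto simp: cycles_of_def)
  then obtain x where x: "x \<in> C" by (auto simp: cyclic_on_def)
  then obtain D where "D \<in> P" "x \<in> D" using C P by (auto simp: partition_on_def)
  then show "C \<in> P"
    using orbit_cyclic_eq3[OF C(2) x] orbit_cyclic_eq3[OF cyc] by metis
qed (use assms in \<open>auto simp: cycles_of_def partition_on_def\<close>)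

lemma partition_cycles_of:
  assumes "\<sigma> permutes {1..n}"
  shows "partition_on {1..n} (cycles_of n \<sigma>)"
proof (rule partition_onI)
  have perm: "permutation \<sigma>"
    using assms by (auto simp: permutation_permutes)
  have "x \<in> \<Union>(cycles_of n \<sigma>)" if "x \<in> {1..n}" for x
    using cyclic_on_orbit'[OF perm, of x] permutes_orbit_subset[OF assms that]
      permutation_self_in_orbit[OF perm, of x] by (auto simp: cycles_of_def)
  then show "\<Union>(cycles_of n \<sigma>) = {1..n}"
    by (auto simp: cycles_of_def)
  show "{} \<notin> cycles_of n \<sigma>"
    by (auto simp: cycles_of_def cyclic_on_def)
  show "disjnt p q" if "p \<in> cycles_of n \<sigma>" "q \<in> cycles_of n \<sigma>" "p \<noteq> q" for p q
    using that orbit_cyclic_eq3[of \<sigma>] unfolding cycles_of_def disjnt_def by blast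
qed

text \<open>The permutation \<open>transpose N b \<circ> \<sigma>\<close> inserts the fixed point \<open>N\<close> of \<open>\<sigma>\<close> just before \<open>b\<close> in its cycle.\<close>

lemma cyclic_on_insert_transpose:
  assumes cyc: "cyclic_on \<sigma> B" and b: "b \<in> B" and N: "N \<notin> B" "\<sigma> N = N"
    and perm: "permutation \<sigma>"
  shows "cyclic_on (transpose N b \<circ> \<sigma>) (insert N B)"
proof -
  let ?\<tau> = "transpose N b \<circ> \<sigma>"
  have "permutation ?\<tau>"
    using perm permutation_swap_id by (rule permutation_compose[rotated])
  then have N_in: "N \<in> orbit ?\<tau> N"
    by (rule permutation_self_in_orbit)
  have tau_N: "?\<tau> N = b"
    using N by simp
  have closed: "\<sigma> y \<in> B" if "y \<in> B" for y
    using cyclic_on_inI[OF cyc that] .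
  have b_in: "b \<in> orbit ?\<tau> N"
    using orbit.base[of ?\<tau> N] tau_N by simp
  \<comment> \<open>On \<open>B\<close> the two maps differ only where \<open>\<sigma>\<close> hits
    \<open>b\<close>, and \<open>b\<close> is in the orbit anyway as the image of
    \<open>N\<close>.\<close>
  have stays: "\<sigma> y \<in> orbit ?\<tau> N" if "y \<in> B" "y \<in> orbit ?\<tau> N" for y
  proof (cases "\<sigma> y = b")
    case False
    moreover have "\<sigma> y \<noteq> N"
      using closed[OF that(1)] N(1) by auto
    ultimately have "?\<tau> y = \<sigma> y" by simp
    then show ?thesis using orbit.step[OF that(2)] by metis
  qed (simp add: b_in)
  have B: "B = orbit \<sigma> b"
    using orbit_cyclic_eq3[OF cyc b] by simp
  have "y \<in> B \<and> y \<in> orbit ?\<tau> N" if "y \<in> orbit \<sigma> b" for y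
    using that
  proof induction
    case base
    then show ?case using stays[OF b b_in] closed[OF b] by (intro conjI)
  next
    case (step y)
    then show ?case using stays closed by blast
  qed
  then have "insert N B \<subseteq> orbit ?\<tau> N"
    using B N_in by auto
  moreover have "y \<in> insert N B" if "y \<in> orbit ?\<tau> N" for y
    using that
  proof induction
    case (step y)
    then show ?case using tau_N b closed[of y] by (auto simp: transpose_def)
  qed (use tau_N b in simp)
  ultimately have "insert N B = orbit ?\<tau> N" by blast
  then show ?thesis by (intro cyclic_on_singleI[of N]) auto
qed

text \<open>For \<open>b = Suc n\<close> the transposition is the identity and \<open>Suc n\<close>
  stays a fixed point, which is the case \<open>B = {}\<close>. Otherwise only the cycle through
  \<open>b\<close> grows; on all other cycles the composition agrees with
  \<open>\<sigma>\<close>.\<close>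

lemma cycles_of_insert_transpose:
  assumes \<sigma>: "\<sigma> permutes {1..n}" and B: "b = Suc n \<and> B = {} \<or> b \<in> B \<and> B \<in> cycles_of n \<sigma>"
  shows "cycles_of (Suc n) (transpose (Suc n) b \<circ> \<sigma>) = insert_in_block (Suc n) (cycles_of n \<sigma>) B"
proof (rule cycles_of_eqI)
  note part = partition_cycles_of[OF \<sigma>]
  have B': "B \<in> insert {} (cycles_of n \<sigma>)"
    using B by auto
  have Suc: "{1..Suc n} = insert (Suc n) {1..n}"
    by auto
  show "partition_on {1..Suc n} (insert_in_block (Suc n) (cycles_of n \<sigma>) B)"
    unfolding Suc by (rule partition_insert_in_block[OF part _ B']) simp
  have perm: "permutation \<sigma>"
    using \<sigma> by (auto simp: permutation_permutes)
  have N_fixed: "\<sigma> (Suc n) = Suc n"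
    using permutes_not_in[OF \<sigma>] by simp
  fix C assume "C \<in> insert_in_block (Suc n) (cycles_of n \<sigma>) B"
  then consider "C = insert (Suc n) B" | "C \<in> cycles_of n \<sigma>" "C \<noteq> B"
    by (auto simp: insert_in_block_def)
  then show "cyclic_on (transpose (Suc n) b \<circ> \<sigma>) C"
  proof cases
    case 1
    show ?thesis
    proof (cases "B = {}")
      case True
      then have "b = Suc n" using B by auto
      then have "orbit (transpose (Suc n) b \<circ> \<sigma>) (Suc n) = {Suc n}"
        using N_fixed by (simp add: orbit_eq_singleton_iff)
      then show ?thesis using 1 True by (intro cyclic_on_singleI[of "Suc n"]) auto
    next
      case False
      then have "b \<in> B" "cyclic_on \<sigma> B" "Suc n \<notin> B"
        using B by (auto simp: cycles_of_def)
      then show ?thesis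
        using cyclic_on_insert_transpose[of \<sigma> B b "Suc n"] N_fixed perm 1 by simp
    qed
  next
    case 2
    then have C: "cyclic_on \<sigma> C" "C \<subseteq> {1..n}"
      by (auto simp: cycles_of_def)
    have "b \<notin> C"
      using B 2 C partition_onD2[OF part] by (auto simp: disjoint_def)
    then have "(transpose (Suc n) b \<circ> \<sigma>) x = \<sigma> x" if "x \<in> C" for x
      using cyclic_on_inI[OF C(1) that] C(2) by (auto simp: transpose_def)
    then show ?thesis using C(1) cyclic_cong by metis
  qed
qed

text \<open>The places are the elements before which \<open>Suc n\<close> can be put, with
  \<open>Suc n\<close> itself standing for a new fixed point. Hence \<open>c n k = n\<close> for any
  number of cycles, the coefficient for \<open>s_odd\<close>.\<close>

global_interpretation permutations: block_insertion
  "\<lambda>n. {\<sigma>. \<sigma> permutes {1..n}}" "\<lambda>n \<sigma>. Min ` cycles_of n \<sigma>" Suc "\<lambda>n \<sigma>. {1..n}"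
  "\<lambda>n (\<sigma>, b). transpose (Suc n) b \<circ> \<sigma>" "\<lambda>n k. n"
  defines permutation_leader_count = permutations.leader_count
proof
  show "card {\<sigma> :: nat \<Rightarrow> nat. \<sigma> permutes {1..0}} = 1"
    by simp
  fix n :: nat
  have Suc: "{1..Suc n} = insert (Suc n) {1..n}"
    by auto
  show "bij_betw (\<lambda>(\<sigma>, b). transpose (Suc n) b \<circ> \<sigma>)
      (SIGMA \<sigma>:{\<sigma>. \<sigma> permutes {1..n}}. insert (Suc n) {1..n}) {\<sigma>. \<sigma> permutes {1..Suc n}}"
    unfolding Suc bij_betw_def
  proof
    show "inj_on (\<lambda>(\<sigma>, b). transpose (Suc n) b \<circ> \<sigma>)
        (SIGMA \<sigma>:{\<sigma>. \<sigma> permutes {1..n}}. insert (Suc n) {1..n})"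
    proof (rule inj_onI, clarify)
      fix \<sigma> b \<sigma>' b'
      assume perm: "\<sigma> permutes {1..n}" "\<sigma>' permutes {1..n}"
        and eq: "transpose (Suc n) b \<circ> \<sigma> = transpose (Suc n) b' \<circ> \<sigma>'"
      have "\<sigma> (Suc n) = Suc n" "\<sigma>' (Suc n) = Suc n"
        using perm[THEN permutes_not_in] by auto
      \<comment> \<open>Both permutations fix \<open>Suc n\<close>, so the value of the composition
        there is \<open>b\<close>.\<close>
      then have "b = b'"
        using fun_cong[OF eq, of "Suc n"] by simp
      have "transpose (Suc n) b \<circ> (transpose (Suc n) b \<circ> \<sigma>) =
          transpose (Suc n) b \<circ> (transpose (Suc n) b \<circ> \<sigma>')"
        using eq \<open>b = b'\<close> by simp
      then show "\<sigma> = \<sigma>' \<and> b = b'"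
        using \<open>b = b'\<close> by (simp flip: comp_assoc)
    qed
    show "(\<lambda>(\<sigma>, b). transpose (Suc n) b \<circ> \<sigma>) ` (SIGMA \<sigma>:{\<sigma>. \<sigma> permutes {1..n}}. insert (Suc n) {1..n}) =
        {\<sigma>. \<sigma> permutes insert (Suc n) {1..n}}"
      unfolding permutes_insert by force
  qed
next
  fix \<sigma> :: "nat \<Rightarrow> nat" and n :: nat
  assume "\<sigma> \<in> {\<sigma>. \<sigma> permutes {1..n}}"
  then have \<sigma>: "\<sigma> permutes {1..n}" by simp
  note part = partition_cycles_of[OF \<sigma>]
  show "Min ` cycles_of n \<sigma> \<subseteq> {1..n}"
    using finite_Min_inj_on_partition[OF part] by simp
  show "Min ` cycles_of (Suc n) (case (\<sigma>, Suc n) of (\<sigma>, b) \<Rightarrow> transpose (Suc n) b \<circ> \<sigma>) =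
      insert (Suc n) (Min ` cycles_of n \<sigma>)"
    using cycles_of_insert_transpose[OF \<sigma>, of "Suc n" "{}"] Min_image_insert_in_block[OF part, of "{}"]
    by simp
  show "Min ` cycles_of (Suc n) (case (\<sigma>, b) of (\<sigma>, b) \<Rightarrow> transpose (Suc n) b \<circ> \<sigma>) =
      Min ` cycles_of n \<sigma>" if b: "b \<in> {1..n}" for b
  proof -
    obtain B where B: "b \<in> B" "B \<in> cycles_of n \<sigma>"
      using b partition_onD1[OF part] by blast
    then have "B \<noteq> {}" "B \<in> insert {} (cycles_of n \<sigma>)"
      by auto
    then have "Min ` insert_in_block (Suc n) (cycles_of n \<sigma>) B = Min ` cycles_of n \<sigma>"
      by (simp only: Min_image_insert_in_block[OF part] if_False)
    moreover have "cycles_of (Suc n) (transpose (Suc n) b \<circ> \<sigma>) =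
        insert_in_block (Suc n) (cycles_of n \<sigma>) B"
      using B by (intro cycles_of_insert_transpose[OF \<sigma>]) simp
    ultimately show ?thesis
      by (simp only: prod.case)
  qed
qed simp_all

lemma s_odd_eq_leader_count: "s_odd (int n) (int k) = int (permutation_leader_count n k)"
proof (induction n arbitrary: k)
  case 0
  then show ?case by (simp add: s_odd_0_left permutations.leader_count_0_left)
next
  case (Suc n)
  show ?case
  proof (cases k)
    case 0
    then show ?thesis
      using s_odd_0_right[of "Suc n"] by (simp add: permutations.leader_count_0_right)
  next
    case (Suc k')
    then show ?thesis
      by (simp only: s_odd_nat_rec Suc.IH permutations.leader_count_Suc of_nat_add of_nat_mult of_nat_of_bool)
  qed
qed

lemma s_odd_eq_card_permutations_with_leader:
  "s_odd (int n) (int k) = int (card (permutations_with_leader n k))"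
proof -
  have "permutations_with_leader n k = {(l, \<sigma>). \<sigma> \<in> {\<sigma>. \<sigma> permutes {1..n}} \<and>
      card (Min ` cycles_of n \<sigma>) = k \<and> l \<in> leaders (Min ` cycles_of n \<sigma>)}"
    unfolding permutations_with_leader_def
    using finite_Min_inj_on_partition[OF partition_cycles_of]
    by (auto simp: card_image is_leader_iff[OF partition_cycles_of])
  then show ?thesis
    using permutations.card_with_leader[of n k] by (simp add: s_odd_eq_leader_count)
qed

section \<open>Stirling permutations\<close>

text \<open>Turns the index condition on Stirling permutations into avoidance of a pattern, which
  passes easily to subsequences and filtered words.\<close>

lemma subseq3_iff_nth:
  "subseq [a, b, c] w \<longleftrightarrow>
     (\<exists>i s j. i < s \<and> s < j \<and> j < length w \<and> w ! i = a \<and> w ! s = b \<and> w ! j = c)"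
proof
  assume "subseq [a, b, c] w"
  then obtain w1 w2 w3 w4 where w: "w = w1 @ a # w2 @ b # w3 @ c # w4"
    by (fastforce dest!: list_emb_ConsD)
  show "\<exists>i s j. i < s \<and> s < j \<and> j < length w \<and> w ! i = a \<and> w ! s = b \<and> w ! j = c"
    by (rule exI[of _ "length w1"], rule exI[of _ "length w1 + 1 + length w2"],
        rule exI[of _ "length w1 + 1 + length w2 + 1 + length w3"])
      (simp add: w nth_append)
next
  assume "\<exists>i s j. i < s \<and> s < j \<and> j < length w \<and> w ! i = a \<and> w ! s = b \<and> w ! j = c"
  then obtain i s j where *: "i < s" "s < j" "j < length w" "w ! i = a" "w ! s = b" "w ! j = c"
    by blast
  obtain Z where "w = take j w @ c # Z"
    using id_take_nth_drop[of j w] * by auto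
  moreover obtain Y where "take j w = take s w @ b # Y"
    using id_take_nth_drop[of s "take j w"] * by (auto simp: min_def)
  moreover obtain X where "take s w = take i w @ a # X"
    using id_take_nth_drop[of i "take s w"] * by (auto simp: min_def)
  ultimately have "w = take i w @ a # X @ b # Y @ c # Z"
    by (metis append.assoc append_Cons)
  moreover have "subseq [a, b, c] (take i w @ a # X @ b # Y @ c # Z)"
    by (intro subseq_drop_many subseq_Cons2) simp
  ultimately show "subseq [a, b, c] w"
    by metis
qed

lemma stirling_permutations_iff:
  "w \<in> stirling_permutations ks \<longleftrightarrow>
     mset w = multiset_of_tuple ks \<and> (\<forall>a b. subseq [a, b, a] w \<longrightarrow> a \<le> b)"
proof -
  have "(\<forall>i s j. i < s \<and> s < j \<and> j < length w \<and> w ! i = w ! j \<longrightarrow> w ! s \<ge> w ! i) \<longleftrightarrow>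
      (\<forall>a b. subseq [a, b, a] w \<longrightarrow> a \<le> b)"
    unfolding subseq3_iff_nth by metis
  then show ?thesis
    by (simp add: stirling_permutations_def permutations_of_multiset_def)
qed

section \<open>The multiset with one letter 0 and two copies of each letter from 1 to n\<close>

definition odd_tuple :: "nat \<Rightarrow> nat list" where
  "odd_tuple n = 1 # replicate n 2"

lemma multiset_odd_tuple_0: "multiset_of_tuple (odd_tuple 0) = {#0#}"
  by (simp add: multiset_of_tuple_def odd_tuple_def lessThan_Suc)

lemma multiset_odd_tuple_Suc:
  "multiset_of_tuple (odd_tuple (Suc n)) = add_mset (Suc n) (add_mset (Suc n) (multiset_of_tuple (odd_tuple n)))"
proof -
  have "(\<Sum>i<Suc n. replicate_mset (odd_tuple (Suc n) ! i) i) = (\<Sum>i<Suc n. replicate_mset (odd_tuple n ! i) i)"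
    by (intro sum.cong) (auto simp: odd_tuple_def nth_Cons split: nat.splits)
  then show ?thesis
    by (simp add: multiset_of_tuple_def odd_tuple_def nth_Cons numeral_2_eq_2 del: replicate_Suc)
qed

lemma set_multiset_odd_tuple: "x \<in># multiset_of_tuple (odd_tuple n) \<Longrightarrow> x \<le> n"
  by (induction n) (auto simp: multiset_odd_tuple_0 multiset_odd_tuple_Suc)

lemma size_multiset_odd_tuple: "size (multiset_of_tuple (odd_tuple n)) = 2 * n + 1"
  by (induction n) (auto simp: multiset_odd_tuple_0 multiset_odd_tuple_Suc)

lemma length_stirling_odd: "w \<in> stirling_permutations (odd_tuple n) \<Longrightarrow> length w = 2 * n + 1"
  using size_multiset_odd_tuple[of n] by (auto simp: stirling_permutations_iff simp flip: size_mset)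

lemma stirling_odd_le:
  assumes "w \<in> stirling_permutations (odd_tuple n)" "x \<in> set w"
  shows "x \<le> n"
  using assms set_multiset_odd_tuple[of x n] unfolding stirling_permutations_iff
  by (metis set_mset_mset)

lemma finite_stirling_permutations: "finite (stirling_permutations ks)"
  by (simp add: stirling_permutations_def)

section \<open>Insertion and deletion of both copies of the largest letter\<close>

definition insert_twice :: "nat \<Rightarrow> nat list \<times> nat \<Rightarrow> nat list" where
  "insert_twice N = (\<lambda>(v, p). take p v @ [N, N] @ drop p v)"

lemma subseq_insert_twice_old: "subseq v (insert_twice N (v, p))"
proof -
  have "subseq (take p v @ drop p v) (take p v @ [N, N] @ drop p v)"
    by (rule list_emb_append_mono) auto
  then show ?thesis by (simp add: insert_twice_def)
qed

lemma not_subseq_insert_twice: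
  assumes "N \<notin> set u" "N \<notin> set t" "b \<noteq> N"
  shows "\<not> subseq [N, b, N] (u @ [N, N] @ t)"
  using assms
proof (induction u)
  case Nil
  have "\<not> subseq [b, N] t"
    using Nil subseq_Cons'[of b "[N]" t] by (auto simp: subseq_singleton_left)
  then show ?case using Nil by simp
qed auto

text \<open>A violation \<open>a, b, a\<close> with \<open>b < a\<close> cannot have
  \<open>a = Suc n\<close>, since the two copies are adjacent. Otherwise it avoids
  \<open>Suc n\<close>, survives the deletion of both copies and so occurs in
  \<open>v\<close>.\<close>

lemma insert_twice_in_stirling:
  assumes v: "v \<in> stirling_permutations (odd_tuple n)" and p: "p \<le> length v"
  shows "insert_twice (Suc n) (v, p) \<in> stirling_permutations (odd_tuple (Suc n))"
  unfolding stirling_permutations_iff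
proof (intro conjI allI impI)
  have "mset (take p v) + mset (drop p v) = mset v"
    by (metis append_take_drop_id mset_append)
  then show "mset (insert_twice (Suc n) (v, p)) = multiset_of_tuple (odd_tuple (Suc n))"
    using v unfolding multiset_odd_tuple_Suc by (simp add: insert_twice_def stirling_permutations_iff)
  have N: "Suc n \<notin> set v"
    using stirling_odd_le[OF v] by fastforce
  then have N': "Suc n \<notin> set (take p v)" "Suc n \<notin> set (drop p v)"
    by (meson in_set_takeD in_set_dropD)+
  have le: "x \<le> Suc n" if "x \<in> set (insert_twice (Suc n) (v, p))" for x
    using that stirling_odd_le[OF v] unfolding insert_twice_def
    by (auto dest!: in_set_takeD in_set_dropD intro: le_SucI)
  fix a b assume sub: "subseq [a, b, a] (insert_twice (Suc n) (v, p))"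
  show "a \<le> b"
  proof (rule ccontr)
    assume "\<not> a \<le> b"
    moreover have "a \<noteq> Suc n"
      using sub \<open>\<not> a \<le> b\<close> not_subseq_insert_twice[OF N', of b] by (auto simp: insert_twice_def)
    moreover have "a \<le> Suc n"
      using subseq_order.order_trans[OF _ sub, of "[a]"] le by (auto simp: subseq_singleton_left)
    ultimately have "filter (\<lambda>x. x \<noteq> Suc n) [a, b, a] = [a, b, a]"
      by auto
    moreover have "filter (\<lambda>x. x \<noteq> Suc n) (insert_twice (Suc n) (v, p)) =
        filter (\<lambda>x. x \<noteq> Suc n) (take p v @ drop p v)"
      by (simp only: insert_twice_def filter_append prod.case) simp
    moreover have "\<dots> = v"
      unfolding append_take_drop_id using N by (intro filter_True) auto
    ultimately have "subseq [a, b, a] v"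
      using subseq_filter[OF sub, of "\<lambda>x. x \<noteq> Suc n"] by simp
    then show False
      using v \<open>\<not> a \<le> b\<close> by (auto simp: stirling_permutations_iff)
  qed
qed

text \<open>A letter between the two copies of \<open>Suc n\<close> would have to be at least
  \<open>Suc n\<close>, while no other letter is that large. So the copies are adjacent, and
  deleting them leaves a subsequence, which inherits the Stirling condition.\<close>

lemma stirling_odd_SucE:
  assumes w: "w \<in> stirling_permutations (odd_tuple (Suc n))"
  obtains v p where "v \<in> stirling_permutations (odd_tuple n)" "p \<le> length v"
    "w = insert_twice (Suc n) (v, p)"
proof -
  let ?N = "Suc n"
  have ms: "mset w = add_mset ?N (add_mset ?N (multiset_of_tuple (odd_tuple n)))"
    and st: "\<And>a b. subseq [a, b, a] w \<Longrightarrow> a \<le> b"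
    using w by (auto simp: stirling_permutations_iff multiset_odd_tuple_Suc)
  have "?N \<in> set w"
    using ms by (metis set_mset_mset union_single_eq_member)
  then obtain xs zs' where w1: "w = xs @ ?N # zs'" "?N \<notin> set xs"
    by (meson split_list_first)
  have "mset xs + mset zs' = add_mset ?N (multiset_of_tuple (odd_tuple n))"
    using ms w1 by simp
  then have "?N \<in> set zs'"
    using w1(2) by (metis set_mset_mset union_iff union_single_eq_member)
  then obtain ys zs where w2: "zs' = ys @ ?N # zs" "?N \<notin> set ys"
    by (meson split_list_first)
  have "ys = []"
  proof (rule ccontr)
    assume "ys \<noteq> []"
    then obtain y ys' where ys: "ys = y # ys'" by (cases ys) auto
    have "subseq [?N, y, ?N] (?N # y # ys' @ ?N # zs)"
      by (simp add: subseq_singleton_left)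
    then have "subseq [?N, y, ?N] w"
      unfolding w1 w2 ys by (auto intro: subseq_drop_many)
    then have "?N \<le> y" by (rule st)
    moreover have "y \<le> ?N"
      using stirling_odd_le[OF w, of y] by (simp add: w1 w2 ys)
    ultimately show False
      using w2(2) ys by auto
  qed
  have w_eq: "w = insert_twice ?N (xs @ zs, length xs)"
    by (simp add: insert_twice_def w1 w2 \<open>ys = []\<close>)
  moreover have "xs @ zs \<in> stirling_permutations (odd_tuple n)"
    unfolding stirling_permutations_iff
  proof (intro conjI allI impI)
    show "mset (xs @ zs) = multiset_of_tuple (odd_tuple n)"
      using ms by (simp add: w1 w2 \<open>ys = []\<close>)
    show "a \<le> b" if "subseq [a, b, a] (xs @ zs)" for a b
      using st subseq_order.order_trans[OF that] subseq_insert_twice_old w_eq by metis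
  qed
  ultimately show ?thesis
    using that[of "xs @ zs" "length xs"] by simp
qed

lemma append_Cons_eq_first:
  assumes "xs @ x # ys = xs' @ x # ys'" "x \<notin> set xs" "x \<notin> set xs'"
  shows "xs = xs' \<and> ys = ys'"
  using assms
proof (induction xs arbitrary: xs')
  case Nil
  then show ?case by (cases xs') auto
next
  case (Cons a xs)
  then show ?case by (cases xs') auto
qed

text \<open>A word of length \<open>2 * n + 1\<close> has \<open>2 * n + 2\<close> gaps, and the
  first copy of \<open>Suc n\<close> marks the gap that was used.\<close>

lemma bij_betw_insert_twice:
  "bij_betw (insert_twice (Suc n)) (stirling_permutations (odd_tuple n) \<times> {0..2 * n + 1})
     (stirling_permutations (odd_tuple (Suc n)))"
  unfolding bij_betw_def
proof
  show "inj_on (insert_twice (Suc n)) (stirling_permutations (odd_tuple n) \<times> {0..2 * n + 1})"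
  proof (rule inj_onI, clarify)
    fix v p v' p'
    assume v: "v \<in> stirling_permutations (odd_tuple n)" "v' \<in> stirling_permutations (odd_tuple n)"
      and p: "p \<in> {0..2 * n + 1}" "p' \<in> {0..2 * n + 1}"
      and eq: "insert_twice (Suc n) (v, p) = insert_twice (Suc n) (v', p')"
    have N: "Suc n \<notin> set v" "Suc n \<notin> set v'"
      using stirling_odd_le[OF v(1)] stirling_odd_le[OF v(2)] by fastforce+
    have N': "Suc n \<notin> set (take p v)" "Suc n \<notin> set (take p' v')"
      using N by (meson in_set_takeD)+
    have split: "take p v @ Suc n # (Suc n # drop p v) = take p' v' @ Suc n # (Suc n # drop p' v')"
      using eq by (simp add: insert_twice_def)
    have "take p v = take p' v' \<and> drop p v = drop p' v'"
      using append_Cons_eq_first[OF split N'] by simp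
    moreover from this have "length (take p v) = length (take p' v')"
      by simp
    then have "p = p'"
      using p length_stirling_odd[OF v(1)] length_stirling_odd[OF v(2)] by simp
    ultimately show "v = v' \<and> p = p'"
      by (metis append_take_drop_id)
  qed
  show "insert_twice (Suc n) ` (stirling_permutations (odd_tuple n) \<times> {0..2 * n + 1}) =
      stirling_permutations (odd_tuple (Suc n))"
  proof (intro set_eqI iffI)
    fix w assume "w \<in> stirling_permutations (odd_tuple (Suc n))"
    then obtain v p where "v \<in> stirling_permutations (odd_tuple n)" "p \<le> length v"
      "w = insert_twice (Suc n) (v, p)"
      by (rule stirling_odd_SucE)
    then show "w \<in> insert_twice (Suc n) ` (stirling_permutations (odd_tuple n) \<times> {0..2 * n + 1})"
      using length_stirling_odd[of v n] by (intro image_eqI[of _ _ "(v, p)"]) auto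
  next
    fix w assume "w \<in> insert_twice (Suc n) ` (stirling_permutations (odd_tuple n) \<times> {0..2 * n + 1})"
    then obtain v p where "v \<in> stirling_permutations (odd_tuple n)" "p \<le> 2 * n + 1"
      "w = insert_twice (Suc n) (v, p)"
      by auto
    then show "w \<in> stirling_permutations (odd_tuple (Suc n))"
      using insert_twice_in_stirling[of v n p] length_stirling_odd[of v n] by simp
  qed
qed

section \<open>Descents under insertion\<close>

text \<open>A descent at \<open>p\<close> is absorbed by the insertion of \<open>N N\<close> at \<open>p\<close>, which creates one at \<open>p + 2\<close>.\<close>

lemma descents_insert_twice:
  assumes N: "\<And>x. x \<in> set v \<Longrightarrow> x < N" and p: "p \<le> length v"
  shows "descents (insert_twice N (v, p)) =
    insert (p + 2) ((\<lambda>i. if i < p then i else i + 2) ` (descents v - {p}))" (is "?L = ?R")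
proof -
  let ?w = "insert_twice N (v, p)"
  have len: "length ?w = length v + 2"
    using p by (simp add: insert_twice_def)
  have nth: "?w ! i = (if i < p then v ! i else if i < p + 2 then N else v ! (i - 2))"
    if "i < length v + 2" for i
  proof -
    have "i = p \<or> i = Suc p" if "\<not> i < p" "i < p + 2"
      using that by auto
    then show ?thesis
      using p that by (auto simp: insert_twice_def nth_append nth_Cons' numeral_2_eq_2)
  qed
  have lt: "v ! i < N" if "i < length v" for i
    using N that by simp
  have low: "i \<in> ?L \<longleftrightarrow> i \<in> descents v" if "i < p" for i
    using that p by (auto simp: descents_def len nth)
  \<comment> \<open>Index \<open>p\<close> is an ascent into \<open>N\<close> (or is 0), index
    \<open>p + 1\<close> compares \<open>N\<close> with itself, and index \<open>p + 2\<close>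
    leaves \<open>N\<close> for a smaller letter or is the end of the word, which counts as a
    descent.\<close>
  have mid: "p \<notin> ?L" "p + 1 \<notin> ?L" "p + 2 \<in> ?L"
  proof -
    have "\<not> N < v ! (p - 1)" if "1 \<le> p"
      using lt[of "p - 1"] that p by linarith
    then show "p \<notin> ?L" "p + 1 \<notin> ?L"
      using p by (auto simp: descents_def len nth)
    show "p + 2 \<in> ?L"
      using p lt[of p] by (auto simp: descents_def len nth)
  qed
  have high: "i + 2 \<in> ?L \<longleftrightarrow> i \<in> descents v" if "p < i" for i
    using that p by (auto simp: descents_def len nth)
  show ?thesis
  proof (intro set_eqI iffI)
    fix i assume i: "i \<in> ?L"
    consider "i < p" | "i = p" | "i = p + 1" | "i = p + 2" | j where "i = j + 2" "p < j"
    proof (cases "p + 2 < i")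
      case True
      then show ?thesis using that(5)[of "i - 2"] by simp
    next
      case False
      then have "i < p \<or> i = p \<or> i = p + 1 \<or> i = p + 2" by linarith
      then show ?thesis using that(1-4) by blast
    qed
    then show "i \<in> ?R"
    proof cases
      case 1
      then have "i \<in> descents v - {p}" using i low by simp
      then show ?thesis using 1 by (intro insertI2 image_eqI[of _ _ i]) auto
    next
      case 5
      then have "j \<in> descents v - {p}" using i high by simp
      then show ?thesis using 5 by (intro insertI2 image_eqI[of _ _ j]) auto
    qed (use i mid in auto)
  next
    fix i assume "i \<in> ?R"
    then show "i \<in> ?L"
      using low high mid(3) by (auto split: if_splits simp: not_less le_less)
  qed
qed

lemma finite_descents: "finite (descents w)"
  by (simp add: descents_def)

text \<open>The shift is injective and misses \<open>p + 2\<close>, so one descent is gained and the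
  one at \<open>p\<close>, if present, is lost.\<close>

lemma card_descents_insert_twice:
  assumes "\<And>x. x \<in> set v \<Longrightarrow> x < N" "p \<le> length v"
  shows "card (descents (insert_twice N (v, p))) = card (descents v) + of_bool (p \<notin> descents v)"
proof -
  let ?g = "\<lambda>i. if i < p then i else i + 2"
  have inj: "inj_on ?g (descents v - {p})"
    by (auto simp: inj_on_def split: if_splits)
  have "descents (insert_twice N (v, p)) = insert (p + 2) (?g ` (descents v - {p}))"
    by (rule descents_insert_twice) (use assms in auto)
  moreover have "p + 2 \<notin> ?g ` (descents v - {p})" "finite (?g ` (descents v - {p}))"
    using finite_descents by auto
  ultimately have "card (descents (insert_twice N (v, p))) = Suc (card (?g ` (descents v - {p})))"
    by (metis card_insert_disjoint)
  also have "\<dots> = Suc (card (descents v - {p}))"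
    unfolding card_image[OF inj] ..
  also have "\<dots> = card (descents v) + of_bool (p \<notin> descents v)"
    using card_Suc_Diff1[OF finite_descents, of p v] by (cases "p \<in> descents v") auto
  finally show ?thesis .
qed

section \<open>The recurrence of the descent numbers\<close>

abbreviation odd_eulerian :: "nat \<Rightarrow> nat \<Rightarrow> nat" where
  "odd_eulerian n \<equiv> stirling_descent_count (odd_tuple n)"

lemma odd_eulerian_0_left: "odd_eulerian 0 i = of_bool (i = 1)"
proof -
  have "stirling_permutations (odd_tuple 0) = {[0]}"
    by (auto simp: stirling_permutations_def multiset_odd_tuple_0 permutations_of_multiset_def)
  moreover have "descents [0] = {1}"
    by (auto simp: descents_def)
  ultimately have "{w \<in> stirling_permutations (odd_tuple 0). card (descents w) = i} = (if i = 1 then {[0]} else {})"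
    by auto
  then show ?thesis
    by (simp add: stirling_descent_count_def)
qed

lemma odd_eulerian_0_right: "odd_eulerian n 0 = 0"
proof -
  have "card (descents w) \<noteq> 0" if "w \<in> stirling_permutations (odd_tuple n)" for w
  proof -
    have "length w \<in> descents w"
      using length_stirling_odd[OF that] by (simp add: descents_def)
    then show ?thesis using finite_descents by auto
  qed
  then have "{w \<in> stirling_permutations (odd_tuple n). card (descents w) = 0} = {}"
    by blast
  then show ?thesis by (simp only: stirling_descent_count_def card.empty)
qed

text \<open>A word with \<open>Suc i\<close> descents comes from one with \<open>Suc i\<close>
  descents by insertion at a descent, or from one with \<open>i\<close> descents by insertion at one
  of the remaining \<open>2 * n + 2 - i\<close> gaps.\<close>

lemma odd_eulerian_Suc:
  "odd_eulerian (Suc n) (Suc i) =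
     Suc i * odd_eulerian n (Suc i) + (2 * n + 2 - i) * odd_eulerian n i"
proof -
  let ?S = "stirling_permutations (odd_tuple n)" and ?I = "{0..2 * n + 1}"
  let ?d = "\<lambda>v. card (descents v)"
  have desc: "?d (insert_twice (Suc n) (v, p)) = ?d v + of_bool (p \<notin> descents v)"
    if "v \<in> ?S" "p \<in> ?I" for v p
    using that stirling_odd_le[of v n] length_stirling_odd[of v n]
    by (intro card_descents_insert_twice) (auto simp: less_Suc_eq_le)
  have "bij_betw (insert_twice (Suc n))
      {x \<in> ?S \<times> ?I. ?d (insert_twice (Suc n) x) = Suc i}
      {w \<in> stirling_permutations (odd_tuple (Suc n)). ?d w = Suc i}"
    using bij_betw_insert_twice[of n] by (rule bij_betw_Collect) auto
  then have "odd_eulerian (Suc n) (Suc i) = card {x \<in> ?S \<times> ?I. ?d (insert_twice (Suc n) x) = Suc i}"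
    unfolding stirling_descent_count_def by (simp add: bij_betw_same_card)
  also have "{x \<in> ?S \<times> ?I. ?d (insert_twice (Suc n) x) = Suc i} =
      (SIGMA v:?S. {p \<in> ?I. ?d v + of_bool (p \<notin> descents v) = Suc i})"
    using desc by auto
  also have "card \<dots> = (\<Sum>v\<in>?S. card {p \<in> ?I. ?d v + of_bool (p \<notin> descents v) = Suc i})"
    by (intro card_SigmaI) (auto simp: finite_stirling_permutations)
  also have "\<dots> = (\<Sum>v\<in>?S. (if ?d v = Suc i then Suc i else 0) + (if ?d v = i then 2 * n + 2 - i else 0))"
  proof (intro sum.cong refl)
    fix v assume v: "v \<in> ?S"
    have sub: "descents v \<subseteq> ?I"
      using length_stirling_odd[OF v] by (auto simp: descents_def)
    consider "?d v = Suc i" | "?d v = i" | "?d v \<noteq> Suc i" "?d v \<noteq> i" by blast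
    then show "card {p \<in> ?I. ?d v + of_bool (p \<notin> descents v) = Suc i} =
        (if ?d v = Suc i then Suc i else 0) + (if ?d v = i then 2 * n + 2 - i else 0)"
    proof cases
      case 1
      then have "{p \<in> ?I. ?d v + of_bool (p \<notin> descents v) = Suc i} = descents v"
        using sub by auto
      then show ?thesis using 1 by simp
    next
      case 2
      then have "{p \<in> ?I. ?d v + of_bool (p \<notin> descents v) = Suc i} = ?I - descents v"
        by auto
      then show ?thesis using 2 sub by (simp add: card_Diff_subset finite_descents)
    next
      case 3
      then have "{p \<in> ?I. ?d v + of_bool (p \<notin> descents v) = Suc i} = {}"
        by (auto split: if_splits)
      then show ?thesis using 3 by simp
    qed
  qed
  also have "\<dots> = Suc i * odd_eulerian n (Suc i) + (2 * n + 2 - i) * odd_eulerian n i"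
    by (simp add: sum.distrib stirling_descent_count_def finite_stirling_permutations
        flip: sum.inter_filter)
  finally show ?thesis .
qed

text \<open>The number of descents starts at one and grows by at most one per insertion.\<close>

lemma odd_eulerian_eq_0: "n + 1 < i \<Longrightarrow> odd_eulerian n i = 0"
proof (induction n arbitrary: i)
  case 0
  then show ?case using odd_eulerian_0_left[of i] by simp
next
  case (Suc n)
  then obtain j where j: "i = Suc j" by (cases i) auto
  with Suc show ?case unfolding j odd_eulerian_Suc by simp
qed

section \<open>Generating functions\<close>

lemma fps_nth_one_minus_X_mult:
  fixes F :: "'a :: comm_ring_1 fps"
  shows "fps_nth ((1 - fps_X) * F) m = fps_nth F m - (if m = 0 then 0 else fps_nth F (m - 1))"
  by (simp add: left_diff_distrib)

lemma fps_nth_X_mult_deriv: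
  fixes F :: "'a :: comm_ring_1 fps"
  shows "fps_nth (fps_X * fps_deriv F) m = of_nat m * fps_nth F m"
  by (cases m) simp_all

lemma fps_nth_X_square_mult_deriv:
  fixes F :: "'a :: comm_ring_1 fps"
  shows "fps_nth (fps_X ^ 2 * fps_deriv F) m = (if m = 0 then 0 else of_nat (m - 1) * fps_nth F (m - 1))"
proof -
  have "fps_X ^ 2 * fps_deriv F = fps_X * (fps_X * fps_deriv F)"
    by (simp add: power2_eq_square mult.assoc)
  then show ?thesis
    using fps_nth_X_mult_deriv[of F "m - 1"] by (simp only: fps_X_mult_nth[of "fps_X * fps_deriv F"])
qed

text \<open>Carries a differential recurrence for series over to their numerators \<open>P\<close>:
  in the derivative of \<open>P\<close>, the term from differentiating the power of
  \<open>1 - fps_X\<close> is cancelled by the summand with factor \<open>Suc d\<close>. It is used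
  with \<open>U = fps_X\<close> and \<open>U = fps_X ^ 2\<close>.\<close>

lemma fps_deriv_recurrence:
  fixes F G P U :: "'a :: comm_ring_1 fps"
  assumes P: "P = (1 - fps_X) ^ Suc d * F" and G: "(1 - fps_X) * G = U * fps_deriv F"
  shows "(1 - fps_X) * (U * fps_deriv P) + of_nat (Suc d) * (U * P) = (1 - fps_X) ^ (Suc d + 2) * G"
proof -
  let ?Y = "1 - fps_X :: 'a fps"
  have deriv: "fps_deriv (?Y ^ Suc d) = - (of_nat (Suc d) * ?Y ^ d)"
    by (simp only: fps_deriv_power fps_of_nat) (simp add: algebra_simps)
  have deriv_P: "fps_deriv P = ?Y ^ Suc d * fps_deriv F - of_nat (Suc d) * (?Y ^ d * F)"
    unfolding P fps_deriv_mult deriv by (simp add: algebra_simps)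
  have "?Y * (U * fps_deriv P) + of_nat (Suc d) * (U * P) = ?Y ^ Suc (Suc d) * (U * fps_deriv F)"
    unfolding deriv_P unfolding P by (simp add: algebra_simps)
  also have "\<dots> = ?Y ^ (Suc d + 2) * G"
    unfolding G[symmetric] by (simp add: algebra_simps)
  finally show ?thesis .
qed

section \<open>Numerator polynomials and their differential recurrences\<close>

definition odd_eulerian_fps :: "nat \<Rightarrow> rat fps" where
  "odd_eulerian_fps n = Abs_fps (\<lambda>i. of_nat (odd_eulerian n i))"

text \<open>Truncated subtraction is harmless here, as \<open>odd_eulerian n 0 = 0\<close>.\<close>

definition odd_eulerian_rev_fps :: "nat \<Rightarrow> rat fps" where
  "odd_eulerian_rev_fps n = Abs_fps (\<lambda>i. of_nat (odd_eulerian n (2 * n + 2 - i)))"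

lemma odd_eulerian_fps_Suc:
  "odd_eulerian_fps (Suc n) =
     (1 - fps_X) * (fps_X * fps_deriv (odd_eulerian_fps n)) +
     of_nat (2 * n + 2) * (fps_X * odd_eulerian_fps n)"
proof (rule fps_ext)
  fix i
  show "fps_nth (odd_eulerian_fps (Suc n)) i =
      fps_nth ((1 - fps_X) * (fps_X * fps_deriv (odd_eulerian_fps n)) +
        of_nat (2 * n + 2) * (fps_X * odd_eulerian_fps n)) i"
  proof (cases i)
    case 0
    then show ?thesis
      by (simp add: odd_eulerian_fps_def odd_eulerian_0_right)
  next
    case (Suc j)
    \<comment> \<open>Where the subtraction truncates, \<open>odd_eulerian n j\<close> is
      zero.\<close>
    have "of_nat (2 * n + 2 - j) * (of_nat (odd_eulerian n j) :: rat) =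
        (of_nat (2 * n + 2) - of_nat j) * of_nat (odd_eulerian n j)"
      by (cases "j \<le> 2 * n + 2") (simp_all add: of_nat_diff odd_eulerian_eq_0)
    then have "(of_nat (odd_eulerian (Suc n) (Suc j)) :: rat) =
        of_nat (Suc j) * of_nat (odd_eulerian n (Suc j)) +
        (of_nat (2 * n + 2) - of_nat j) * of_nat (odd_eulerian n j)"
      unfolding odd_eulerian_Suc of_nat_add of_nat_mult by simp
    then show ?thesis
      unfolding Suc fps_add_nth fps_nth_one_minus_X_mult fps_nth_X_mult_deriv fps_mult_of_nat_nth
      by (simp add: odd_eulerian_fps_def algebra_simps)
  qed
qed

text \<open>Reversal swaps the two factors in \<open>odd_eulerian_Suc\<close>: the falling one
  becomes the derivative term and vice versa. The power \<open>fps_X ^ 2\<close> appears because the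
  centre of reversal \<open>2 * n + 2\<close> moves by two.\<close>

lemma odd_eulerian_rev_fps_Suc:
  "odd_eulerian_rev_fps (Suc n) =
     (1 - fps_X) * (fps_X ^ 2 * fps_deriv (odd_eulerian_rev_fps n)) +
     of_nat (2 * n + 2) * (fps_X ^ 2 * odd_eulerian_rev_fps n)"
proof (rule fps_ext)
  fix i
  let ?Q = "odd_eulerian_rev_fps n"
  show "fps_nth (odd_eulerian_rev_fps (Suc n)) i =
      fps_nth ((1 - fps_X) * (fps_X ^ 2 * fps_deriv ?Q) + of_nat (2 * n + 2) * (fps_X ^ 2 * ?Q)) i"
  proof (cases "i < 2")
    case True
    \<comment> \<open>These coefficients would count words with more than \<open>n + 2\<close>
      descents.\<close>
    then have "odd_eulerian (Suc n) (2 * Suc n + 2 - i) = 0"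
      by (intro odd_eulerian_eq_0) simp
    moreover have "i = 0 \<or> i = 1"
      using True by auto
    ultimately show ?thesis
      unfolding fps_add_nth fps_nth_one_minus_X_mult fps_nth_X_square_mult_deriv fps_mult_of_nat_nth
      by (auto simp: odd_eulerian_rev_fps_def fps_X_power_mult_nth)
  next
    case False
    then obtain j where i: "i = j + 2"
      using le_Suc_ex[of 2 i] by (auto simp: add.commute)
    have eq: "(of_nat (odd_eulerian (Suc n) (2 * n + 2 - j)) :: rat) =
        of_nat (Suc j) * of_nat (odd_eulerian n (2 * n + 1 - j)) +
        (of_nat (2 * n + 2) - of_nat j) * of_nat (odd_eulerian n (2 * n + 2 - j))"
    proof (cases "j \<le> 2 * n + 1")
      case True
      then have *: "2 * n + 2 - j = Suc (2 * n + 1 - j)" "2 * n + 2 - (2 * n + 1 - j) = Suc j"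
        by auto
      have "odd_eulerian (Suc n) (2 * n + 2 - j) =
          (2 * n + 2 - j) * odd_eulerian n (2 * n + 2 - j) + Suc j * odd_eulerian n (2 * n + 1 - j)"
        unfolding *(1) odd_eulerian_Suc *(2) ..
      then show ?thesis
        using True by (simp only: of_nat_add of_nat_mult) (simp add: of_nat_diff algebra_simps)
    \<comment> \<open>For larger \<open>j\<close> all second indices truncate to 0.\<close>
    qed (simp add: odd_eulerian_0_right)
    have nth: "fps_nth ?Q k = of_nat (odd_eulerian n (2 * n + 2 - k))" for k
      by (simp add: odd_eulerian_rev_fps_def)
    have "fps_nth (odd_eulerian_rev_fps (Suc n)) i = of_nat (odd_eulerian (Suc n) (2 * n + 2 - j))"
      by (simp add: odd_eulerian_rev_fps_def i)
    moreover have "fps_nth ((1 - fps_X) * (fps_X ^ 2 * fps_deriv ?Q) + of_nat (2 * n + 2) * (fps_X ^ 2 * ?Q)) i =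
        of_nat (Suc j) * of_nat (odd_eulerian n (2 * n + 1 - j)) +
        (of_nat (2 * n + 2) - of_nat j) * of_nat (odd_eulerian n (2 * n + 2 - j))"
      unfolding fps_add_nth fps_nth_one_minus_X_mult fps_nth_X_square_mult_deriv fps_mult_of_nat_nth fps_X_power_mult_nth i
      by (simp add: nth algebra_simps)
    ultimately show ?thesis
      using eq by simp
  qed
qed

section \<open>Generating functions along the diagonals of \<open>S_odd\<close> and
  \<open>s_odd\<close>\<close>

definition S_odd_fps :: "nat \<Rightarrow> rat fps" where
  "S_odd_fps n = Abs_fps (\<lambda>m. of_int (S_odd (int n + int m) (int m)))"

definition s_odd_fps :: "nat \<Rightarrow> rat fps" where
  "s_odd_fps n = Abs_fps (\<lambda>m. of_int (s_odd (int m) (int m - int n)))"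

text \<open>This is \<open>S_odd_shift_rec\<close> read coefficientwise: \<open>1 - fps_X\<close>
  takes differences in \<open>m\<close>, and \<open>fps_X\<close> times the derivative multiplies by
  \<open>m\<close>.\<close>

lemma S_odd_fps_Suc: "(1 - fps_X) * S_odd_fps (Suc n) = fps_X * fps_deriv (S_odd_fps n)"
proof (rule fps_ext)
  fix m
  show "fps_nth ((1 - fps_X) * S_odd_fps (Suc n)) m = fps_nth (fps_X * fps_deriv (S_odd_fps n)) m"
    unfolding fps_nth_one_minus_X_mult fps_nth_X_mult_deriv
  proof (cases m)
    case 0
    then show "fps_nth (S_odd_fps (Suc n)) m - (if m = 0 then 0 else fps_nth (S_odd_fps (Suc n)) (m - 1)) =
        of_nat m * fps_nth (S_odd_fps n) m"
      using S_odd_0_right[of "Suc n"] by (simp add: S_odd_fps_def)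
  next
    case (Suc k)
    then show "fps_nth (S_odd_fps (Suc n)) m - (if m = 0 then 0 else fps_nth (S_odd_fps (Suc n)) (m - 1)) =
        of_nat m * fps_nth (S_odd_fps n) m"
      unfolding S_odd_fps_def fps_nth_Abs_fps Suc S_odd_shift_rec by simp
  qed
qed

lemma s_odd_fps_Suc: "(1 - fps_X) * s_odd_fps (Suc n) = fps_X ^ 2 * fps_deriv (s_odd_fps n)"
proof (rule fps_ext)
  fix m
  show "fps_nth ((1 - fps_X) * s_odd_fps (Suc n)) m = fps_nth (fps_X ^ 2 * fps_deriv (s_odd_fps n)) m"
    unfolding fps_nth_one_minus_X_mult fps_nth_X_square_mult_deriv
  proof (cases m)
    case 0
    then show "fps_nth (s_odd_fps (Suc n)) m - (if m = 0 then 0 else fps_nth (s_odd_fps (Suc n)) (m - 1)) =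
        (if m = 0 then 0 else of_nat (m - 1) * fps_nth (s_odd_fps n) (m - 1))"
      by (simp add: s_odd_fps_def s_odd_0_left)
  next
    case (Suc k)
    then show "fps_nth (s_odd_fps (Suc n)) m - (if m = 0 then 0 else fps_nth (s_odd_fps (Suc n)) (m - 1)) =
        (if m = 0 then 0 else of_nat (m - 1) * fps_nth (s_odd_fps n) (m - 1))"
      unfolding s_odd_fps_def fps_nth_Abs_fps Suc s_odd_shift_rec by simp
  qed
qed

text \<open>The base of both inductions below, as the main diagonals are
  \<open>m \<mapsto> m\<close>.\<close>

lemma fps_X_eq_square_mult: "fps_X = (1 - fps_X) ^ 2 * (Abs_fps of_nat :: rat fps)"
proof (rule fps_ext)
  fix m
  show "fps_nth fps_X m = fps_nth ((1 - fps_X) ^ 2 * (Abs_fps of_nat :: rat fps)) m"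
    unfolding power2_eq_square mult.assoc fps_nth_one_minus_X_mult
    by (cases m; cases "m - 1") auto
qed

text \<open>Both sides equal \<open>fps_X\<close> for \<open>n = 0\<close> and obey the same
  recurrence, by \<open>fps_deriv_recurrence\<close> with \<open>d = 2 * n + 1\<close>.\<close>

lemma odd_eulerian_fps_eq: "odd_eulerian_fps n = (1 - fps_X) ^ (2 * n + 2) * S_odd_fps n"
proof (induction n)
  case 0
  have "odd_eulerian_fps 0 = fps_X"
    by (rule fps_ext) (simp add: odd_eulerian_fps_def odd_eulerian_0_left)
  moreover have "S_odd_fps 0 = Abs_fps of_nat"
    by (simp add: S_odd_fps_def S_odd_diag)
  ultimately show ?case
    using fps_X_eq_square_mult by (simp only: mult_0_right add_0)
next
  case (Suc n)
  show ?case
    using fps_deriv_recurrence[of "odd_eulerian_fps n" "2 * n + 1", OF _ S_odd_fps_Suc] Suc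
    by (simp add: odd_eulerian_fps_Suc)
qed

lemma odd_eulerian_rev_fps_eq: "odd_eulerian_rev_fps n = (1 - fps_X) ^ (2 * n + 2) * s_odd_fps n"
proof (induction n)
  case 0
  have "odd_eulerian_rev_fps 0 = fps_X"
    by (rule fps_ext) (auto simp: odd_eulerian_rev_fps_def odd_eulerian_0_left)
  moreover have "s_odd_fps 0 = Abs_fps of_nat"
    by (simp add: s_odd_fps_def s_odd_diag)
  ultimately show ?case
    using fps_X_eq_square_mult by (simp only: mult_0_right add_0)
next
  case (Suc n)
  show ?case
    using fps_deriv_recurrence[of "odd_eulerian_rev_fps n" "2 * n + 1", OF _ s_odd_fps_Suc] Suc
    by (simp add: odd_eulerian_rev_fps_Suc)
qed

lemma one_minus_fps_X_power_nonzero: "(1 - fps_X :: rat fps) ^ k \<noteq> 0"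
proof -
  have "fps_nth (1 - fps_X :: rat fps) 0 \<noteq> fps_nth 0 0"
    by simp
  then have "(1 - fps_X :: rat fps) \<noteq> 0"
    by metis
  then show ?thesis by simp
qed

lemma length_odd_tuple: "length (odd_tuple n) = n + 1"
  and sum_list_odd_tuple: "sum_list (odd_tuple n) = 2 * n + 1"
  by (simp_all add: odd_tuple_def sum_list_replicate)

lemma fps_nth_sum_monomials:
  fixes a :: "nat \<Rightarrow> nat"
  assumes "finite I"
  shows "fps_nth (\<Sum>i\<in>I. of_nat (a i) * fps_X ^ i :: rat fps) j = (if j \<in> I then of_nat (a j) else 0)"
proof -
  have "fps_nth (\<Sum>i\<in>I. of_nat (a i) * fps_X ^ i :: rat fps) j = (\<Sum>i\<in>I. if i = j then of_nat (a j) else 0)"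
    unfolding fps_sum_nth fps_mult_of_nat_nth by (intro sum.cong) auto
  then show ?thesis using assms by simp
qed

lemma stirling_B_odd: "stirling_B (odd_tuple n) m = of_int (S_odd (int n + int m) (int m))"
proof -
  have "(\<Sum>i = 1..n + 1. of_nat (odd_eulerian n i) * fps_X ^ i) = odd_eulerian_fps n"
  proof (rule fps_ext)
    fix j
    have "odd_eulerian n j = 0" if "j \<notin> {1..n + 1}"
      using that odd_eulerian_0_right[of n] odd_eulerian_eq_0[of n j] by (cases "j = 0") auto
    then show "fps_nth (\<Sum>i = 1..n + 1. of_nat (odd_eulerian n i) * fps_X ^ i) j = fps_nth (odd_eulerian_fps n) j"
      unfolding fps_nth_sum_monomials[OF finite_atLeastAtMost]
      by (simp add: odd_eulerian_fps_def del: One_nat_def)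
  qed
  then show ?thesis
    unfolding stirling_B_def length_odd_tuple sum_list_odd_tuple
    by (simp add: odd_eulerian_fps_eq one_minus_fps_X_power_nonzero S_odd_fps_def
        nonzero_mult_div_cancel_left del: power_Suc One_nat_def)
qed

lemma stirling_b_odd: "stirling_b (odd_tuple n) m = of_int (s_odd (int m) (int m - int n))"
proof -
  have "(\<Sum>i = n + 1..2 * n + 1. of_nat (odd_eulerian n (2 * n + 2 - i)) * fps_X ^ i) =
      odd_eulerian_rev_fps n"
  proof (rule fps_ext)
    fix j
    \<comment> \<open>Below the range the index exceeds \<open>n + 1\<close>; above it the index
      truncates to 0.\<close>
    have "odd_eulerian n (2 * n + 2 - j) = 0" if "j \<notin> {n + 1..2 * n + 1}"
      using that odd_eulerian_0_right[of n] odd_eulerian_eq_0[of n "2 * n + 2 - j"]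
      by (cases "j < n + 1") auto
    then show "fps_nth (\<Sum>i = n + 1..2 * n + 1. of_nat (odd_eulerian n (2 * n + 2 - i)) * fps_X ^ i) j =
        fps_nth (odd_eulerian_rev_fps n) j"
      unfolding fps_nth_sum_monomials[OF finite_atLeastAtMost]
      by (simp add: odd_eulerian_rev_fps_def)
  qed
  moreover have "2 * n + 1 - (n + 1) + 1 = n + 1" "2 * n + 1 + 1 = 2 * n + 2"
    by simp_all
  ultimately show ?thesis
    unfolding stirling_b_def length_odd_tuple sum_list_odd_tuple
    by (simp only: odd_eulerian_rev_fps_eq nonzero_mult_div_cancel_left[OF one_minus_fps_X_power_nonzero])
      (simp add: s_odd_fps_def)
qed

section \<open>Sums over monotone sequences\<close>

text \<open>The relation is a parameter, so that weakly and strictly increasing indices share the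
  splitting of the last entry.\<close>

definition sorted_tuples :: "('a \<Rightarrow> 'a \<Rightarrow> bool) \<Rightarrow> nat \<Rightarrow> 'a set \<Rightarrow> 'a list set" where
  "sorted_tuples r n A = {xs. length xs = n \<and> set xs \<subseteq> A \<and> sorted_wrt r xs}"

lemma finite_sorted_tuples: "finite A \<Longrightarrow> finite (sorted_tuples r n A)"
  unfolding sorted_tuples_def
  by (rule finite_subset[OF _ finite_lists_length_eq[of A n]]) auto

text \<open>No element of \<open>A\<close> may follow \<open>x\<close>, so a tuple in which
  \<open>x\<close> occurs must end in \<open>x\<close>.\<close>

lemma sorted_tuples_Suc_insert:
  assumes "\<And>a. a \<in> A \<Longrightarrow> \<not> r x a"
  shows "sorted_tuples r (Suc n) (insert x A) = sorted_tuples r (Suc n) A \<union>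
    (\<lambda>ys. ys @ [x]) ` {ys \<in> sorted_tuples r n (insert x A). \<forall>y\<in>set ys. r y x}" (is "?L = ?R")
proof
  show "?L \<subseteq> ?R"
  proof
    fix xs assume "xs \<in> ?L"
    moreover from this obtain ys z where "xs = ys @ [z]"
      unfolding sorted_tuples_def by (cases xs rule: rev_cases) auto
    ultimately show "xs \<in> ?R"
      using assms by (cases "z = x") (auto simp: sorted_tuples_def sorted_wrt_append)
  qed
  show "?R \<subseteq> ?L"
    by (auto simp: sorted_tuples_def sorted_wrt_append)
qed

lemma sum_sorted_tuples_Suc_insert:
  assumes "finite A" "x \<notin> A" "\<And>a. a \<in> A \<Longrightarrow> \<not> r x a"
  shows "sum f (sorted_tuples r (Suc n) (insert x A)) = sum f (sorted_tuples r (Suc n) A) +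
    (\<Sum>ys\<in>{ys \<in> sorted_tuples r n (insert x A). \<forall>y\<in>set ys. r y x}. f (ys @ [x]))"
proof -
  let ?T = "{ys \<in> sorted_tuples r n (insert x A). \<forall>y\<in>set ys. r y x}"
  have fin: "finite (sorted_tuples r (Suc n) A)" "finite ((\<lambda>ys. ys @ [x]) ` ?T)"
    using assms(1) by (auto intro!: finite_imageI finite_sorted_tuples)
  have "sorted_tuples r (Suc n) A \<inter> (\<lambda>ys. ys @ [x]) ` ?T = {}"
    using assms(2) by (auto simp: sorted_tuples_def)
  moreover have "sorted_tuples r (Suc n) (insert x A) =
      sorted_tuples r (Suc n) A \<union> (\<lambda>ys. ys @ [x]) ` ?T"
    by (rule sorted_tuples_Suc_insert) (rule assms(3))
  ultimately have "sum f (sorted_tuples r (Suc n) (insert x A)) =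
      sum f (sorted_tuples r (Suc n) A) + sum f ((\<lambda>ys. ys @ [x]) ` ?T)"
    by (simp only: sum.union_disjoint[OF fin])
  also have "sum f ((\<lambda>ys. ys @ [x]) ` ?T) = (\<Sum>ys\<in>?T. f (ys @ [x]))"
    by (subst sum.reindex) (auto simp: inj_on_def)
  finally show ?thesis .
qed

definition tuple_weight :: "nat list \<Rightarrow> nat" where
  "tuple_weight xs = (xs ! 0)\<^sup>2 * (\<Prod>j = 1..<length xs. xs ! j)"

lemma tuple_weight_snoc: "xs \<noteq> [] \<Longrightarrow> tuple_weight (xs @ [x]) = tuple_weight xs * x"
proof -
  assume ne: "xs \<noteq> []"
  then have "{1..<Suc (length xs)} = insert (length xs) {1..<length xs}"
    by (cases xs) auto
  then have "(\<Prod>j = 1..<length (xs @ [x]). (xs @ [x]) ! j) = x * (\<Prod>j = 1..<length xs. (xs @ [x]) ! j)"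
    by simp
  also have "(\<Prod>j = 1..<length xs. (xs @ [x]) ! j) = (\<Prod>j = 1..<length xs. xs ! j)"
    by (intro prod.cong) (auto simp: nth_append)
  finally show ?thesis
    using ne by (simp add: tuple_weight_def nth_append)
qed

text \<open>The first index is squared, so appending \<open>x\<close> to the empty tuple gives
  \<open>x * x\<close>. With the value \<open>x\<close> standing in for the empty sum, the case
  \<open>n = 0\<close> takes the same shape as the others.\<close>

lemma sum_weight_snoc:
  "(\<Sum>ys\<in>sorted_tuples r n A. tuple_weight (ys @ [x])) =
     x * (if n = 0 then x else sum tuple_weight (sorted_tuples r n A))"
proof (cases "n = 0")
  case True
  then have "sorted_tuples r n A = {[]}"
    by (auto simp: sorted_tuples_def)
  then show ?thesis
    using True by (simp add: tuple_weight_def power2_eq_square)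
next
  case False
  then have "(\<Sum>ys\<in>sorted_tuples r n A. tuple_weight (ys @ [x])) =
      (\<Sum>ys\<in>sorted_tuples r n A. x * tuple_weight ys)"
    by (intro sum.cong) (auto simp: sorted_tuples_def tuple_weight_snoc)
  then show ?thesis
    using False by (simp add: sum_distrib_left)
qed

lemma sorted_tuples_Suc_empty: "sorted_tuples r (Suc n) {} = {}"
  by (auto simp: sorted_tuples_def)

text \<open>Tuples over \<open>{1..Suc m}\<close> either avoid \<open>Suc m\<close> or end in it,
  which reproduces \<open>S_odd_shift_rec\<close>. For \<open>n = 0\<close> the diagonal value
  \<open>m\<close> matches the convention in \<open>sum_weight_snoc\<close>.\<close>

lemma S_odd_eq_sum_weight:
  "S_odd (int n + int m) (int m) =
     int (if n = 0 then m else sum tuple_weight (sorted_tuples (\<le>) n {1..m}))"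
proof (induction n arbitrary: m)
  case 0
  then show ?case by (simp add: S_odd_diag)
next
  case (Suc n)
  note outer = Suc.IH
  show ?case
  proof (induction m)
    case 0
    then show ?case
      using S_odd_0_right[of "Suc n"] by (simp add: sorted_tuples_Suc_empty)
  next
    case (Suc m)
    have ins: "{1..Suc m} = insert (Suc m) {1..m}"
      by auto
    have all: "{ys \<in> sorted_tuples (\<le>) n (insert (Suc m) {1..m}). \<forall>y\<in>set ys. y \<le> Suc m} =
        sorted_tuples (\<le>) n (insert (Suc m) {1..m})"
      by (auto simp: sorted_tuples_def)
    have "sum tuple_weight (sorted_tuples (\<le>) (Suc n) {1..Suc m}) =
        sum tuple_weight (sorted_tuples (\<le>) (Suc n) {1..m}) +
        (\<Sum>ys\<in>sorted_tuples (\<le>) n {1..Suc m}. tuple_weight (ys @ [Suc m]))"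
      unfolding ins by (subst sum_sorted_tuples_Suc_insert) (auto simp only: all finite_atLeastAtMost, auto)
    then show ?case
      unfolding S_odd_shift_rec Suc.IH outer sum_weight_snoc by (simp only: nat.distinct if_False of_nat_add of_nat_mult)
  qed
qed

lemma s_odd_eq_sum_weight:
  "s_odd (int m) (int m - int n) =
     int (if n = 0 then m else sum tuple_weight (sorted_tuples (<) n {1..<m}))"
proof (induction n arbitrary: m)
  case 0
  then show ?case by (simp add: s_odd_diag)
next
  case (Suc n)
  note outer = Suc.IH
  show ?case
  proof (induction m)
    case 0
    then show ?case
      by (simp add: sorted_tuples_Suc_empty s_odd_0_left)
  next
    case (Suc m)
    have "sum tuple_weight (sorted_tuples (<) (Suc n) {1..<Suc m}) =
        sum tuple_weight (sorted_tuples (<) (Suc n) {1..<m}) +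
        m * (if n = 0 then m else sum tuple_weight (sorted_tuples (<) n {1..<m}))"
    proof (cases "m = 0")
      case False
      then have ins: "{1..<Suc m} = insert m {1..<m}"
        by auto
      \<comment> \<open>Strictness keeps \<open>m\<close> out of the earlier entries, so the upper
        bound drops along with the last index.\<close>
      have below: "{ys \<in> sorted_tuples (<) n (insert m {1..<m}). \<forall>y\<in>set ys. y < m} =
          sorted_tuples (<) n {1..<m}"
        using False by (auto simp: sorted_tuples_def subset_iff)
      show ?thesis
        unfolding ins sum_weight_snoc[symmetric]
        by (subst sum_sorted_tuples_Suc_insert) (auto simp only: below finite_atLeastLessThan, auto)
    qed (simp add: sorted_tuples_Suc_empty)
    then show ?case
      unfolding s_odd_shift_rec Suc.IH outer by (simp only: nat.distinct if_False of_nat_add of_nat_mult)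
  qed
qed

theorem theorem4:
  shows
    "(\<forall>n k :: nat. 1 \<le> k \<and> k \<le> n \<longrightarrow>
        S_odd (int n) (int k) = int (card (partitions_with_leader n k))) \<and>
     (\<forall>n k :: nat. 1 \<le> k \<and> k \<le> n \<longrightarrow>
        s_odd (int n) (int k) = int (card (permutations_with_leader n k))) \<and>
     (\<forall>n m :: nat. 1 \<le> m \<longrightarrow>
        stirling_B (1 # replicate n 2) m = of_int (S_odd (int n + int m) (int m)) \<and>
        stirling_b (1 # replicate n 2) m = of_int (s_odd (int m) (int m - int n))) \<and>
     (\<forall>n m :: nat. 1 \<le> n \<and> 1 \<le> m \<longrightarrow>
        S_odd (int n + int m) (int m) =
          int (\<Sum>xs | length xs = n \<and> set xs \<subseteq> {1..m} \<and> sorted_wrt (\<le>) xs.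
                 (xs ! 0)\<^sup>2 * (\<Prod>j = 1..<n. xs ! j)) \<and>
        s_odd (int m) (int m - int n) =
          int (\<Sum>xs | length xs = n \<and> set xs \<subseteq> {1..<m} \<and> sorted_wrt (<) xs.
                 (xs ! 0)\<^sup>2 * (\<Prod>j = 1..<n. xs ! j)))"
proof (intro conjI allI impI)
  fix n m :: nat
  show "stirling_B (1 # replicate n 2) m = of_int (S_odd (int n + int m) (int m))"
    using stirling_B_odd[of n m] by (simp only: odd_tuple_def)
  show "stirling_b (1 # replicate n 2) m = of_int (s_odd (int m) (int m - int n))"
    using stirling_b_odd[of n m] by (simp only: odd_tuple_def)
next
  fix n m :: nat
  assume "1 \<le> n \<and> 1 \<le> m"
  then have "n \<noteq> 0" by simp
  have weight: "sum tuple_weight (sorted_tuples r n A) =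
      (\<Sum>xs | length xs = n \<and> set xs \<subseteq> A \<and> sorted_wrt r xs. (xs ! 0)\<^sup>2 * (\<Prod>j = 1..<n. xs ! j))" for r A
    unfolding sorted_tuples_def by (intro sum.cong) (auto simp: tuple_weight_def)
  show "S_odd (int n + int m) (int m) =
      int (\<Sum>xs | length xs = n \<and> set xs \<subseteq> {1..m} \<and> sorted_wrt (\<le>) xs.
        (xs ! 0)\<^sup>2 * (\<Prod>j = 1..<n. xs ! j))"
    using S_odd_eq_sum_weight[of n m] \<open>n \<noteq> 0\<close> by (simp only: weight if_False)
  show "s_odd (int m) (int m - int n) =
      int (\<Sum>xs | length xs = n \<and> set xs \<subseteq> {1..<m} \<and> sorted_wrt (<) xs.
        (xs ! 0)\<^sup>2 * (\<Prod>j = 1..<n. xs ! j))"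
    using s_odd_eq_sum_weight[of m n] \<open>n \<noteq> 0\<close> by (simp only: weight if_False)
qed (rule S_odd_eq_card_partitions_with_leader s_odd_eq_card_permutations_with_leader)+

end
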